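(* Suppose Assumption A holds. Let $\tau^*$ be a strong mean field equilibrium and let $\mu=\mathbb{P}^{\mathrm{com}}\times\mathbb{P}^{\mathrm{ind}}[\tau^*\in\cdot\,|\,W^0]$. For each $k\ge1$ define on $\overline{\Omega}$ the $\mathbb{F}^k$-stopping time $\tau^k(\omega^0,\omega^1,\omega^2,\ldots)=\tau^*(\omega^0,\omega^k)$. Then there exist $\epsilon_n\ge 0$ with $\epsilon_n\to0$ such that $\vec\tau^{\,n}=(\tau^1,\ldots,\tau^n)$ is an $\epsilon_n$-Nash equilibrium of the $n$-player game for each $n$, and moreover, for each $k$, \[ \lim_{n\to\infty}\mathbb{E}\big[F(W^0,W^k,\overline{\mu}^n(\vec\tau^{\,n}),\tau^k)\big]=\mathbb{E}\big[F(W^0,W^1,\mu,\tau^* )\big]. \]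
   Context: General setting. Fix a compact set $\mathbb{T}\subset[0,\infty]$, either discrete or of the form $[0,T]$ with $T\in[0,\infty]$. $\mathcal{P}(\mathbb{T})$ is the set of Borel probability measures on $\mathbb{T}$; $m[0,t]:=m([0,t])$. Fix two filtered probability spaces $(\Omega^{\mathrm{com}},\mathcal{F}^{\mathrm{com}},\mathbb{F}^{\mathrm{com}},\mathbb{P}^{\mathrm{com}})$ (common noise) and $(\Omega^{\mathrm{ind}},\mathcal{F}^{\mathrm{ind}},\mathbb{F}^{\mathrm{ind}},\mathbb{P}^{\mathrm{ind}})$ (idiosyncratic noise), with filtrations indexed by $\mathbb{T}$, and a filtration $\mathbb{F}^{\mathrm{sig}}=(\mathcal{F}^{\mathrm{sig}}_t)_{t\in\mathbb{T}}$ on $\Omega^{\mathrm{com}}\times\Omega^{\mathrm{ind}}$ with $\mathcal{F}^{\mathrm{sig}}_t\subset\mathcal{F}^{\mathrm{com}}_t\otimes\mathcal{F}^{\mathrm{ind}}_t$. The space $\Omega^{\mathrm{com}}\times\Omega^{\mathrm{ind}}$ carries the product measure $\mathbb{P}^{\mathrm{com}}\times\mathbb{P}^{\mathrm{ind}}$ with expectation $\mathbb{E}$; $W^0,W^1$ denote the projections onto $\Omega^{\mathrm{com}}$ and $\Omega^{\mathrm{ind}}$. An objective function $F:\Omega^{\mathrm{com}}\times\Omega^{\mathrm{ind}}\times\mathcal{P}(\mathbb{T})\times\mathbb{T}\to\mathbb{R}$ is given. Stopping times take values in $\mathbb{T}$. Strong MFE: an $\mathbb{F}^{\mathrm{sig}}$-stopping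 time $\tau^*$ on $\Omega^{\mathrm{com}}\times\Omega^{\mathrm{ind}}$ such that $\mathbb{E}[F(W^0,W^1,\mu,\tau^* )]\ge\mathbb{E}[F(W^0,W^1,\mu,\tau)]$ for every $\mathbb{F}^{\mathrm{sig}}$-stopping time $\tau$, where $\mu=\mathbb{P}^{\mathrm{com}}\times\mathbb{P}^{\mathrm{ind}}[\tau^*\in\cdot\,|\,W^0]$ is the regular conditional law of $\tau^*$ given $W^0$. $n$-player game: $(\overline\Omega,\overline{\mathcal F},\overline{\mathbb F},\overline{\mathbb P})$ is the product of $(\Omega^{\mathrm{com}},\ldots,\mathbb{P}^{\mathrm{com}})$ with countably many copies of $(\Omega^{\mathrm{ind}},\ldots,\mathbb{P}^{\mathrm{ind}})$; elements are $(\omega^0,\omega^1,\ldots)$, $W^i(\omega^0,\omega^1,\ldots)=\omega^i$, and agent $i\ge1$ has filtration $\mathcal{F}^i_t=(W^0,W^i)^{-1}(\mathcal{F}^{\mathrm{sig}}_t)$. Expectation on $\overline\Omega$ is also written $\mathbb{E}$. The empirical measure is $\overline\mu^n(t_1,\ldots,t_n)=\frac1n\sum_{k=1}^n\delta_{t_k}$; for $\vec t\in\mathbb{T}^n$, $(\vec t^{\,-i},s)$ denotes $\vec t$ with its $i$th entry replaced by $s$. For $\epsilon\ge0$, $\vec\tau=(\tau_1,\ldots,\tau_n)$ is an $\epsilon$-Nash equilibrium if each $\tau_i$ is an $\mathbb{F}^i$-stopping time and $\mathbb{E}[F(W^0,W^i,\overline\mu^n(\vec\tau),\tau_i)]\ge\mathbb{E}[F(W^0,W^i,\overline\mu^n(\vec\tau^{\,-i},\sigma),\sigma)]-\epsilon$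 for every $\mathbb{F}^i$-stopping time $\sigma$ and each $i=1,\ldots,n$. Topology: $B(\mathbb{T})$ is the set of bounded measurable functions on $\mathbb{T}$ and $\sigma(\mathcal{P}(\mathbb{T}),B(\mathbb{T}))$ the coarsest topology making $m\mapsto\int\varphi\,dm$ continuous for all $\varphi\in B(\mathbb{T})$. Assumption A: (A.1) $F$ is jointly measurable, with $\mathcal{P}(\mathbb{T})$ carrying the $\sigma$-field generated by $m\mapsto m(C)$, $C$ Borel. (A.2) For almost every $(\omega^0,\omega^1)$ and every $m_0\in\mathcal{P}(\mathbb{T})$, the map $m\mapsto\sup_{t\in\mathbb{T}}|F(\omega^0,\omega^1,m,t)-F(\omega^0,\omega^1,m_0,t)|$ is $\sigma(\mathcal{P}(\mathbb{T}),B(\mathbb{T}))$-continuous at $m_0$. (A.3) $\mathbb{E}[\sup_{m\in\mathcal{P}(\mathbb{T})}\sup_{t\in\mathbb{T}}|F(W^0,W^1,m,t)|]<\infty$. *)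

theory Defs
  imports "HOL-Probability.Probability"
begin

text \<open>Time set: a compact subset of [0,\<infinity>], modelled in ennreal.
  "Discrete" is read as countable.\<close>
definition admissible_time_set :: "ennreal set \<Rightarrow> bool" where
  "admissible_time_set T \<longleftrightarrow> compact T \<and> (countable T \<or> (\<exists>S. T = {0..S}))"

definition BT :: "ennreal set \<Rightarrow> ennreal measure" where
  "BT T = restrict_space borel T"

definition PT :: "ennreal set \<Rightarrow> ennreal measure measure" where
  "PT T = prob_algebra (BT T)"

definition tau_topology :: "ennreal set \<Rightarrow> ennreal measure topology" where
  "tau_topology T = topology_generated_by
     {{m \<in> space (PT T). (\<integral>t. \<phi> t \<partial>m) \<in> U} | \<phi> U.
        \<phi> \<in> borel_measurable (BT T) \<and> bounded (\<phi> ` T) \<and> open (U :: real set)}"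

definition filtration_on :: "ennreal set \<Rightarrow> 'a measure \<Rightarrow> (ennreal \<Rightarrow> 'a measure) \<Rightarrow> bool" where
  "filtration_on T M F \<longleftrightarrow> (\<forall>t\<in>T. subalgebra M (F t)) \<and>
     (\<forall>s\<in>T. \<forall>t\<in>T. s \<le> t \<longrightarrow> sets (F s) \<subseteq> sets (F t))"

definition stopping_time_on :: "ennreal set \<Rightarrow> 'a measure \<Rightarrow> (ennreal \<Rightarrow> 'a measure) \<Rightarrow> ('a \<Rightarrow> ennreal) \<Rightarrow> bool" where
  "stopping_time_on T M F \<tau> \<longleftrightarrow> (\<forall>x\<in>space M. \<tau> x \<in> T) \<and> \<tau> \<in> borel_measurable M \<and>
     (\<forall>t\<in>T. {x \<in> space M. \<tau> x \<le> t} \<in> sets (F t))"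

definition setting :: "ennreal set \<Rightarrow> 'a measure \<Rightarrow> (ennreal \<Rightarrow> 'a measure) \<Rightarrow>
    'b measure \<Rightarrow> (ennreal \<Rightarrow> 'b measure) \<Rightarrow> (ennreal \<Rightarrow> ('a \<times> 'b) measure) \<Rightarrow> bool" where
  "setting T P0 F0 P1 F1 Fsig \<longleftrightarrow> admissible_time_set T \<and>
     prob_space P0 \<and> prob_space P1 \<and> filtration_on T P0 F0 \<and> filtration_on T P1 F1 \<and>
     filtration_on T (P0 \<Otimes>\<^sub>M P1) Fsig \<and> (\<forall>t\<in>T. sets (Fsig t) \<subseteq> sets (F0 t \<Otimes>\<^sub>M F1 t))"

definition cond_law :: "ennreal set \<Rightarrow> 'a measure \<Rightarrow> 'b measure \<Rightarrow> ('a \<times> 'b \<Rightarrow> ennreal) \<Rightarrow>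
    ('a \<Rightarrow> ennreal measure) \<Rightarrow> bool" where
  "cond_law T P0 P1 \<tau> \<mu> \<longleftrightarrow> \<mu> \<in> P0 \<rightarrow>\<^sub>M PT T \<and>
     (\<forall>A\<in>sets (BT T). \<forall>B\<in>sets P0.
        (\<integral>\<^sup>+ w0. indicator B w0 * emeasure (\<mu> w0) A \<partial>P0) =
        emeasure (P0 \<Otimes>\<^sub>M P1) {w \<in> space (P0 \<Otimes>\<^sub>M P1). \<tau> w \<in> A \<and> fst w \<in> B})"

definition payoff :: "'a measure \<Rightarrow> 'b measure \<Rightarrow> ('a \<Rightarrow> 'b \<Rightarrow> ennreal measure \<Rightarrow> ennreal \<Rightarrow> real) \<Rightarrow>
    ('a \<Rightarrow> ennreal measure) \<Rightarrow> ('a \<times> 'b \<Rightarrow> ennreal) \<Rightarrow> real" where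
  "payoff P0 P1 F \<mu> \<tau> = (\<integral>w. F (fst w) (snd w) (\<mu> (fst w)) (\<tau> w) \<partial>(P0 \<Otimes>\<^sub>M P1))"

definition strong_MFE where
  "strong_MFE T P0 P1 Fsig F \<tau> \<longleftrightarrow> stopping_time_on T (P0 \<Otimes>\<^sub>M P1) Fsig \<tau> \<and>
     (\<exists>\<mu>. cond_law T P0 P1 \<tau> \<mu> \<and>
        (\<forall>\<sigma>. stopping_time_on T (P0 \<Otimes>\<^sub>M P1) Fsig \<sigma> \<longrightarrow>
               payoff P0 P1 F \<mu> \<sigma> \<le> payoff P0 P1 F \<mu> \<tau>))"

definition assumptionA where
  "assumptionA T P0 P1 F \<longleftrightarrow>
     (\<lambda>(w0, w1, m, t). F w0 w1 m t) \<in> borel_measurable (P0 \<Otimes>\<^sub>M P1 \<Otimes>\<^sub>M PT T \<Otimes>\<^sub>M BT T) \<and>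
     (AE w in P0 \<Otimes>\<^sub>M P1. \<forall>m0\<in>space (PT T).
        limitin euclidean (\<lambda>m. SUP t\<in>T. ereal \<bar>F (fst w) (snd w) m t - F (fst w) (snd w) m0 t\<bar>)
          0 (atin (tau_topology T) m0)) \<and>
     (\<lambda>w. SUP m\<in>space (PT T). SUP t\<in>T. ennreal \<bar>F (fst w) (snd w) m t\<bar>) \<in> borel_measurable (P0 \<Otimes>\<^sub>M P1) \<and>
     (\<integral>\<^sup>+ w. (SUP m\<in>space (PT T). SUP t\<in>T. ennreal \<bar>F (fst w) (snd w) m t\<bar>) \<partial>(P0 \<Otimes>\<^sub>M P1)) < \<infinity>"

definition Obar :: "'a measure \<Rightarrow> 'b measure \<Rightarrow> ('a \<times> (nat \<Rightarrow> 'b)) measure" where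
  "Obar P0 P1 = P0 \<Otimes>\<^sub>M (\<Pi>\<^sub>M i\<in>{1..}. P1)"

definition agent_filtration where
  "agent_filtration P0 P1 Fsig i t =
     vimage_algebra (space (Obar P0 P1)) (\<lambda>w. (fst w, snd w i)) (Fsig t)"

definition empirical :: "ennreal set \<Rightarrow> nat \<Rightarrow> (nat \<Rightarrow> ennreal) \<Rightarrow> ennreal measure" where
  "empirical T n ts = measure_of T (sets (BT T))
     (\<lambda>A. ennreal (real (card {k \<in> {1..n}. ts k \<in> A}) / real n))"

definition game_payoff where
  "game_payoff T P0 P1 F n \<tau>s i =
     (\<integral>w. F (fst w) (snd w i) (empirical T n (\<lambda>k. \<tau>s k w)) (\<tau>s i w) \<partial>Obar P0 P1)"

definition eps_Nash where
  "eps_Nash T P0 P1 Fsig F n \<epsilon> \<tau>s \<longleftrightarrow>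
     (\<forall>i\<in>{1..n}. stopping_time_on T (Obar P0 P1) (agent_filtration P0 P1 Fsig i) (\<tau>s i) \<and>
        (\<forall>\<sigma>. stopping_time_on T (Obar P0 P1) (agent_filtration P0 P1 Fsig i) \<sigma> \<longrightarrow>
           game_payoff T P0 P1 F n (\<tau>s(i := \<sigma>)) i - \<epsilon> \<le> game_payoff T P0 P1 F n \<tau>s i))"

end

theory Submission
  imports Defs "HOL-Real_Asymp.Real_Asymp"
begin

text \<open>Given the common noise \<open>w0\<close>, the times \<open>\<tau> (w0, W\<^sup>k)\<close> are i.i.d. with law \<open>\<mu> w0\<close>. The empirical
  measures need not converge to \<open>\<mu> w0\<close> almost surely in the topology generated by all bounded measurable
  functions, but every neighbourhood of \<open>\<mu> w0\<close> is controlled by finitely many test functions, so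
  Hoeffding's inequality gives convergence in probability, and one deviating agent shifts each test
  integral by only \<open>O(1/n)\<close>. Hence, conditionally on \<open>(w0, w1)\<close>, replacing the empirical measure by \<open>\<mu> w0\<close>
  changes the expected reward by an amount that tends to 0 uniformly in the deviating agent and its stopping
  time. That supremum over deviations need not be measurable in \<open>(w0, w1)\<close>; therefore dominated convergence
  is applied along an arbitrary sequence of near-optimal deviations. An agent's best deviation in the
  \<open>n\<close>-player game is then compared with the mean field problem, where \<open>\<tau>\<close> is optimal.\<close>

section \<open>Empirical measures as random elements of the space of probability measures\<close>

lemma space_BT [simp]: "space (BT T) = T"
  by (simp add: BT_def space_restrict_space)

lemma space_PT: "space (PT T) = {m. sets m = sets (BT T) \<and> prob_space m}"
  by (simp add: PT_def space_prob_algebra)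

text \<open>\<open>measure_of\<close> yields the intended measure only for a countably additive set
  function. Recognising the formula as the law of \<open>ts\<close> under a uniformly chosen index
  settles this and makes the calculus of \<open>distr\<close> available.\<close>

lemma empirical_eq_distr:
  assumes "\<And>k. k \<in> {1..n} \<Longrightarrow> ts k \<in> T"
  shows "empirical T n ts = distr (uniform_count_measure {1..n}) (BT T) ts"
proof -
  let ?N = "distr (uniform_count_measure {1..n}) (BT T) ts"
  have ts: "ts \<in> uniform_count_measure {1..n} \<rightarrow>\<^sub>M BT T"
    using assms by (auto simp: measurable_def space_uniform_count_measure sets_uniform_count_measure)
  have "empirical T n ts = measure_of T (sets (BT T)) (emeasure ?N)"
    unfolding empirical_def
  proof (rule measure_of_eq)
    show "sets (BT T) \<subseteq> Pow T"
      using sets.space_closed[of "BT T"] by simp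
    fix A assume "A \<in> sigma_sets T (sets (BT T))"
    then have A: "A \<in> sets (BT T)"
      using sets.sigma_sets_eq[of "BT T"] by simp
    have "{k \<in> {1..n}. ts k \<in> A} = ts -` A \<inter> {1..n}" by auto
    then show "ennreal (real (card {k \<in> {1..n}. ts k \<in> A}) / real n) = emeasure ?N A"
      using ts A by (simp add: emeasure_distr space_uniform_count_measure
          emeasure_uniform_count_measure)
  qed
  also have "\<dots> = ?N"
    using measure_of_of_measure[of ?N] by simp
  finally show ?thesis .
qed

lemma empirical_in_space_PT:
  assumes "n \<ge> 1" "\<And>k. k \<in> {1..n} \<Longrightarrow> ts k \<in> T"
  shows "empirical T n ts \<in> space (PT T)"
proof -
  have "prob_space (uniform_count_measure {1..n})"
    using assms by (intro prob_space_uniform_count_measure) auto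
  then have "prob_space (distr (uniform_count_measure {1..n}) (BT T) ts)"
    using assms by (intro prob_space.prob_space_distr)
      (auto simp: measurable_def space_uniform_count_measure sets_uniform_count_measure)
  then show ?thesis
    using empirical_eq_distr[OF assms(2)] by (simp add: space_PT)
qed

lemma integral_empirical:
  fixes \<phi> :: "ennreal \<Rightarrow> real"
  assumes "\<And>k. k \<in> {1..n} \<Longrightarrow> ts k \<in> T" and "\<phi> \<in> borel_measurable (BT T)"
  shows "(\<integral>t. \<phi> t \<partial>empirical T n ts) = (\<Sum>k\<in>{1..n}. \<phi> (ts k)) / n"
proof -
  have "ts \<in> uniform_count_measure {1..n} \<rightarrow>\<^sub>M BT T"
    using assms by (auto simp: measurable_def space_uniform_count_measure sets_uniform_count_measure)
  then show ?thesis
    using assms(2) by (subst empirical_eq_distr[OF assms(1)])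
      (auto simp: integral_distr integral_uniform_count_measure)
qed

text \<open>The sigma-algebra on \<open>PT T\<close> is generated by the evaluations at sets of
  \<open>BT T\<close>, and each evaluation of an empirical measure is a finite average of measurable
  indicators.\<close>

lemma measurable_empirical:
  assumes "n \<ge> 1" and X: "\<And>k. k \<in> {1..n} \<Longrightarrow> X k \<in> M \<rightarrow>\<^sub>M BT T"
  shows "(\<lambda>w. empirical T n (\<lambda>k. X k w)) \<in> M \<rightarrow>\<^sub>M PT T"
  unfolding PT_def
proof (intro measurable_prob_algebraI measurable_subprob_algebra)
  have XT: "X k w \<in> T" if "k \<in> {1..n}" "w \<in> space M" for k w
    using measurable_space[OF X that(2)] that(1) by simp
  have PT: "empirical T n (\<lambda>k. X k w) \<in> space (PT T)" if "w \<in> space M" for w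
    using assms(1) XT that by (intro empirical_in_space_PT) auto
  show "prob_space (empirical T n (\<lambda>k. X k w))"
    and "subprob_space (empirical T n (\<lambda>k. X k w))"
    and "sets (empirical T n (\<lambda>k. X k w)) = sets (BT T)" if "w \<in> space M" for w
    using PT[OF that] by (auto simp: space_PT intro: prob_space_imp_subprob_space)
  fix A assume A: "A \<in> sets (BT T)"
  have "emeasure (empirical T n (\<lambda>k. X k w)) A = ennreal ((\<Sum>k\<in>{1..n}. indicator A (X k w)) / n)"
    if "w \<in> space M" for w
  proof -
    interpret prob_space "empirical T n (\<lambda>k. X k w)"
      using PT[OF that] by (simp add: space_PT)
    have "A \<in> sets (empirical T n (\<lambda>k. X k w))"
      using PT[OF that] A by (simp add: space_PT)
    then have "measure (empirical T n (\<lambda>k. X k w)) A =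
        (\<integral>t. indicator A t \<partial>empirical T n (\<lambda>k. X k w))"
      by simp
    also have "\<dots> = (\<Sum>k\<in>{1..n}. indicator A (X k w)) / n"
      using XT that A by (intro integral_empirical) auto
    finally show ?thesis by (simp add: emeasure_eq_measure)
  qed
  moreover have "(\<lambda>w. ennreal ((\<Sum>k\<in>{1..n}. indicator A (X k w)) / n)) \<in> borel_measurable M"
    using X A by measurable
  ultimately show "(\<lambda>w. emeasure (empirical T n (\<lambda>k. X k w)) A) \<in> borel_measurable M"
    by (subst measurable_cong) auto
qed

section \<open>Neighbourhoods in the topology of bounded measurable test functions\<close>

lemma topspace_tau_topology: "topspace (tau_topology T) = space (PT T)"
proof -
  have "space (PT T) = {m \<in> space (PT T). (\<integral>t. (0::real) \<partial>m) \<in> UNIV}" by simp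
  moreover have "(\<lambda>_. 0 :: real) \<in> borel_measurable (BT T)" "bounded ((\<lambda>_. 0 :: real) ` T)"
    by (auto simp: bounded_iff)
  ultimately show ?thesis
    unfolding tau_topology_def topology_generated_by_topspace by blast
qed

text \<open>Induction over the generation of open sets: a subbasic set needs one test function, an
  intersection merges two families and keeps the smaller radius, and a union inherits the data of
  the member containing \<open>m0\<close>. Finiteness of the family is what later permits a union
  bound.\<close>

lemma tau_topology_basic_neighbourhood:
  assumes "openin (tau_topology T) U" "m0 \<in> U"
  shows "\<exists>(\<Phi> :: (ennreal \<Rightarrow> real) set) \<delta>. finite \<Phi> \<and> (\<forall>\<phi>\<in>\<Phi>. \<phi> \<in> borel_measurable (BT T) \<and> bounded (\<phi> ` T)) \<and> \<delta> > 0 \<and>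
    (\<forall>m\<in>space (PT T). (\<forall>\<phi>\<in>\<Phi>. \<bar>(\<integral>t. \<phi> t \<partial>m) - (\<integral>t. \<phi> t \<partial>m0)\<bar> < \<delta>) \<longrightarrow> m \<in> U)"
proof -
  define nbhd where "nbhd \<Phi> \<delta> V \<longleftrightarrow> finite \<Phi> \<and> (\<forall>\<phi>\<in>\<Phi>. \<phi> \<in> borel_measurable (BT T) \<and> bounded (\<phi> ` T)) \<and> \<delta> > 0 \<and>
    (\<forall>m\<in>space (PT T). (\<forall>\<phi>\<in>\<Phi>. \<bar>(\<integral>t. \<phi> t \<partial>m) - (\<integral>t. \<phi> t \<partial>m0)\<bar> < \<delta>) \<longrightarrow> m \<in> V)"
    for \<Phi> and \<delta> :: real and V
  have "generate_topology_on {{m \<in> space (PT T). (\<integral>t. \<phi> t \<partial>m) \<in> U} | \<phi> U.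
        \<phi> \<in> borel_measurable (BT T) \<and> bounded (\<phi> ` T) \<and> open (U :: real set)} U"
    using assms(1) unfolding tau_topology_def by (rule openin_topology_generated_by)
  then have "\<exists>\<Phi> \<delta>. nbhd \<Phi> \<delta> U" using assms(2)
  proof induction
    case Empty
    then show ?case by simp
  next
    case (Int a b)
    then obtain \<Phi> \<delta> \<Psi> \<epsilon> where "nbhd \<Phi> \<delta> a" "nbhd \<Psi> \<epsilon> b" by blast
    then have "nbhd (\<Phi> \<union> \<Psi>) (min \<delta> \<epsilon>) (a \<inter> b)"
      unfolding nbhd_def by auto
    then show ?case by blast
  next
    case (UN K)
    then obtain k where "k \<in> K" "m0 \<in> k" by blast
    then obtain \<Phi> \<delta> where "nbhd \<Phi> \<delta> k" using UN.IH by blast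
    then have "nbhd \<Phi> \<delta> (\<Union>K)" using \<open>k \<in> K\<close> unfolding nbhd_def by blast
    then show ?case by blast
  next
    case (Basis s)
    then obtain \<phi> V where s: "s = {m \<in> space (PT T). (\<integral>t. \<phi> t \<partial>m) \<in> V}"
      and \<phi>: "\<phi> \<in> borel_measurable (BT T)" "bounded (\<phi> ` T)" and V: "open (V :: real set)"
      by blast
    have "(\<integral>t. \<phi> t \<partial>m0) \<in> V" using Basis s by simp
    then obtain \<delta> where \<delta>: "\<delta> > 0" "\<And>y. dist y (\<integral>t. \<phi> t \<partial>m0) < \<delta> \<Longrightarrow> y \<in> V"
      using V unfolding open_dist by blast
    have "nbhd {\<phi>} \<delta> s" using \<phi> \<delta> by (auto simp: nbhd_def s dist_real_def)
    then show ?case by blast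
  qed  then show ?thesis unfolding nbhd_def .
qed

lemma tau_continuous_neighbourhood:
  fixes f :: "ennreal measure \<Rightarrow> ennreal \<Rightarrow> real"
  assumes lim: "limitin euclidean (\<lambda>m. SUP t\<in>T. ereal \<bar>f m t - f m0 t\<bar>) 0 (atin (tau_topology T) m0)"
    and m0: "m0 \<in> space (PT T)" and "\<eta> > 0"
  shows "\<exists>(\<Phi> :: (ennreal \<Rightarrow> real) set) \<delta>. finite \<Phi> \<and> (\<forall>\<phi>\<in>\<Phi>. \<phi> \<in> borel_measurable (BT T) \<and> bounded (\<phi> ` T)) \<and> \<delta> > 0 \<and>
    (\<forall>m\<in>space (PT T). (\<forall>\<phi>\<in>\<Phi>. \<bar>(\<integral>t. \<phi> t \<partial>m) - (\<integral>t. \<phi> t \<partial>m0)\<bar> < \<delta>) \<longrightarrow>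
      (\<forall>t\<in>T. \<bar>f m t - f m0 t\<bar> \<le> \<eta>))"
proof -
  have "eventually (\<lambda>m. (SUP t\<in>T. ereal \<bar>f m t - f m0 t\<bar>) < ereal \<eta>) (atin (tau_topology T) m0)"
    using lim \<open>\<eta> > 0\<close> unfolding limitin_canonical_iff by (auto intro!: order_tendstoD)
  then obtain U where U: "openin (tau_topology T) U" "m0 \<in> U"
    and le: "\<And>m. m \<in> U - {m0} \<Longrightarrow> (SUP t\<in>T. ereal \<bar>f m t - f m0 t\<bar>) < ereal \<eta>"
    using m0 unfolding eventually_atin topspace_tau_topology by auto
  have "\<bar>f m t - f m0 t\<bar> \<le> \<eta>" if "m \<in> U" "t \<in> T" for m t
  \<comment> \<open>The filter \<open>atin\<close> is punctured at \<open>m0\<close>, so the limit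
    says nothing there; at \<open>m0\<close> itself the difference is 0.\<close>
  proof (cases "m = m0")
    case False
    then have "ereal \<bar>f m t - f m0 t\<bar> \<le> ereal \<eta>"
      using le[of m] that SUP_upper[of t T "\<lambda>t. ereal \<bar>f m t - f m0 t\<bar>"]
      by (auto simp del: ereal_less_eq intro: order.trans less_imp_le)
    then show ?thesis by simp
  qed (use \<open>\<eta> > 0\<close> in simp)
  then show ?thesis
    using tau_topology_basic_neighbourhood[OF U] by meson
qed


section \<open>Determining classes, concentration and the conditional law\<close>

text \<open>Half-lines with endpoints in a countable dense set form, together with
  \<open>UNIV\<close>, an intersection-stable generator of the Borel sets. A countable class is
  needed because conditional laws agree on each fixed set only up to a null set depending on that
  set. \<open>UNIV\<close> serves as the exhausting set, since no open half-line contains the point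
  infinity.\<close>

lemma prob_measure_eqI_dense:
  fixes D :: "ennreal set"
  assumes dense: "\<And>x y. x < y \<Longrightarrow> \<exists>d\<in>D. x < d \<and> d < y" and D: "countable D"
    and M: "prob_space M" "sets M = sets (BT T)" and N: "prob_space N" "sets N = sets (BT T)"
    and eq: "\<And>d. d \<in> D \<Longrightarrow> emeasure M (T \<inter> {..<d}) = emeasure N (T \<inter> {..<d})"
  shows "M = N"
proof -
  let ?G = "insert UNIV (lessThan ` D)"
  have "sets borel = sets (sigma UNIV (range (lessThan :: ennreal \<Rightarrow> _)))"
    by (subst borel_Iio) simp
  also have "\<dots> = sigma_sets UNIV ?G"
  proof -
    have "{..<a} \<in> sigma_sets UNIV ?G" for a
    proof -
      have "{..<a} = (\<Union>d\<in>{d\<in>D. d \<le> a}. {..<d})"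
        using dense by (fastforce intro: less_imp_le order.strict_trans2)
      moreover have "(\<Union>d\<in>{d\<in>D. d \<le> a}. {..<d}) \<in> sigma_sets UNIV ?G"
        using D by (intro sigma_sets_UNION) auto
      ultimately show ?thesis by simp
    qed
    moreover have "UNIV \<in> sigma_sets UNIV (range (lessThan :: ennreal \<Rightarrow> _))"
      by (rule sigma_sets_top)
    ultimately have "sigma_sets UNIV (range lessThan) = sigma_sets UNIV ?G"
      by (intro sigma_sets_eqI) auto
    then show ?thesis by simp
  qed
  finally have gen: "sets borel = sigma_sets UNIV ?G" .
  have spM: "space M = T" "space N = T"
    using sets_eq_imp_space_eq[OF M(2)] sets_eq_imp_space_eq[OF N(2)] by simp_all
  have id: "id \<in> K \<rightarrow>\<^sub>M borel" if "sets K = sets (BT T)" for K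
    unfolding measurable_cong_sets[OF that refl] BT_def id_def
    by (rule measurable_restrict_space1) simp
  note id = id[OF M(2)] id[OF N(2)]
  \<comment> \<open>Both measures are moved to all of \<open>ennreal\<close>, where the generator
    consists of genuine half-lines instead of their traces on \<open>T\<close>.\<close>
  have "distr M borel id = distr N borel id"
  proof (rule measure_eqI_generator_eq[where E = ?G and \<Omega> = UNIV and A = "\<lambda>_. UNIV"])
    show "Int_stable ?G"
    proof (rule Int_stableI)
      fix a b assume "a \<in> ?G" "b \<in> ?G"
      moreover have "{..<x} \<inter> {..<y} \<in> lessThan ` D" if "x \<in> D" "y \<in> D" for x y
      proof -
        have "{..<x} \<inter> {..<y} = {..<min x y}" by auto
        then show ?thesis using that by (simp add: min_def)
      qed
      ultimately show "a \<inter> b \<in> ?G" by auto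
    qed
    show "emeasure (distr M borel id) X = emeasure (distr N borel id) X" if "X \<in> ?G" for X
      using that id eq prob_space.emeasure_space_1[OF M(1)] prob_space.emeasure_space_1[OF N(1)]
      by (auto simp: emeasure_distr spM Int_commute)
    show "emeasure (distr M borel id) UNIV \<noteq> \<infinity>"
      using id prob_space.emeasure_space_1[OF M(1)] by (simp add: emeasure_distr)
  qed (use gen in auto)
  then have eq_distr: "emeasure (distr M borel id) B = emeasure (distr N borel id) B" for B by simp
  have *: "emeasure M (T \<inter> B) = emeasure N (T \<inter> B)" if "B \<in> sets borel" for B
    using eq_distr[of B] that id by (simp add: emeasure_distr spM Int_commute)
  show ?thesis
  proof (rule measure_eqI)
    show "sets M = sets N" using M N by simp
    fix A assume "A \<in> sets M"
    then obtain B where "A = T \<inter> B" "B \<in> sets borel"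
      by (auto simp: M BT_def sets_restrict_space)
    then show "emeasure M A = emeasure N A" using * by simp
  qed
qed

text \<open>The coordinates of a product space are independent with law \<open>P\<close>, so
  Hoeffding's inequality applies. Each summand ranges over an interval of length
  \<open>2 * C\<close>; the squared lengths add up to \<open>4 * C\<^sup>2 * card J\<close>, which
  gives the exponent.\<close>

lemma PiM_concentration:
  fixes g :: "'b \<Rightarrow> real" and C :: real
  assumes P: "prob_space P" and J: "finite J" "J \<noteq> {}" "J \<subseteq> I"
    and g: "g \<in> borel_measurable P" and C: "\<And>x. x \<in> space P \<Longrightarrow> \<bar>g x\<bar> \<le> C" "C > 0" and e: "\<epsilon> \<ge> 0"
  shows "measure (\<Pi>\<^sub>M i\<in>I. P) {v \<in> space (\<Pi>\<^sub>M i\<in>I. P). \<epsilon> \<le> \<bar>(\<Sum>k\<in>J. g (v k)) - card J * (\<integral>x. g x \<partial>P)\<bar>}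
    \<le> 2 * exp (- \<epsilon>\<^sup>2 / (2 * C\<^sup>2 * card J))"
proof -
  let ?Q = "\<Pi>\<^sub>M i\<in>I. P"
  interpret Q: prob_space ?Q using P by (intro prob_space_PiM)
  have comp: "distr ?Q P (\<lambda>v. v k) = P" if "k \<in> J" for k
    using J that P by (intro distr_PiM_component[where M="\<lambda>_. P"]) auto
  have "Q.indep_vars (\<lambda>_. P) (\<lambda>k v. v k) J"
  \<comment> \<open>Independence is read off from the joint law: restricting the product over
    \<open>I\<close> to \<open>J\<close> gives the product over \<open>J\<close> of the
    marginals.\<close>
  proof (subst Q.indep_vars_iff_distr_eq_PiM'[OF J(2)])
    have "distr ?Q (\<Pi>\<^sub>M i\<in>J. P) (\<lambda>v. \<lambda>k\<in>J. v k) = (\<Pi>\<^sub>M i\<in>J. P)"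
      using distr_PiM_reindex[of I "\<lambda>_. P" "\<lambda>k. k" J] P J by (auto simp: subset_iff)
    then show "distr ?Q (\<Pi>\<^sub>M i\<in>J. P) (\<lambda>v. \<lambda>k\<in>J. v k) = (\<Pi>\<^sub>M k\<in>J. distr ?Q P (\<lambda>v. v k))"
      using comp by (simp cong: PiM_cong)
  qed (use J in auto)
  then have indep: "Q.indep_vars (\<lambda>_. borel) (\<lambda>k v. g (v k)) J"
    using g by (rule Q.indep_vars_compose2)
  interpret Hoeffding_ineq ?Q J "\<lambda>k v. g (v k)" "\<lambda>_. -C" "\<lambda>_. C" "\<Sum>k\<in>J. Q.expectation (\<lambda>v. g (v k))"
  proof unfold_locales
    show "AE v in ?Q. g (v k) \<in> {-C..C}" if "k \<in> J" for k
    proof (rule AE_I2)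
      fix v assume "v \<in> space ?Q"
      then have "v k \<in> space P" using that J by (auto simp: space_PiM)
      then show "g (v k) \<in> {-C..C}" using C(1)[of "v k"] by auto
    qed
  qed (use J indep in auto)
  have "Q.expectation (\<lambda>v. g (v k)) = (\<integral>x. g x \<partial>P)" if "k \<in> J" for k
  proof -
    have "(\<integral>x. g x \<partial>P) = (\<integral>x. g x \<partial>distr ?Q P (\<lambda>v. v k))" using comp[OF that] by simp
    also have "\<dots> = Q.expectation (\<lambda>v. g (v k))"
      using that J g by (intro integral_distr) auto
    finally show ?thesis by simp
  qed
  then have "(\<Sum>k\<in>J. Q.expectation (\<lambda>v. g (v k))) = card J * (\<integral>x. g x \<partial>P)" by simp
  moreover have "(\<Sum>k\<in>J. (C - - C)\<^sup>2) = 4 * C\<^sup>2 * card J"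
    by (simp add: power2_eq_square)
  moreover have "card J > 0" using J by (simp add: card_gt_0_iff)
  ultimately show ?thesis
    using Hoeffding_ineq_abs_ge[OF e] C(2) by (simp add: field_simps)
qed

text \<open>By Tonelli, the sections of \<open>\<tau>\<close> define a version of the conditional
  law, and two versions agree almost everywhere. Consequently, for almost every common noise, the
  times of the agents are independent with law \<open>\<mu> w0\<close>.\<close>

lemma cond_law_AE_eq:
  assumes "prob_space P0" "prob_space P1" and \<tau> [measurable]: "\<tau> \<in> P0 \<Otimes>\<^sub>M P1 \<rightarrow>\<^sub>M BT T"
    and cl: "cond_law T P0 P1 \<tau> \<mu>"
  shows "AE w0 in P0. \<mu> w0 = distr P1 (BT T) (\<lambda>y. \<tau> (w0, y))"
proof -
  interpret P0: prob_space P0 by fact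
  interpret P1: prob_space P1 by fact
  have \<mu>: "\<mu> \<in> P0 \<rightarrow>\<^sub>M PT T" using cl by (simp add: cond_law_def)
  obtain D :: "ennreal set" where D: "countable D" "\<And>X. open X \<Longrightarrow> X \<noteq> {} \<Longrightarrow> \<exists>d\<in>D. d \<in> X"
    using countable_dense_setE by blast
  have dense_D: "\<exists>d\<in>D. x < d \<and> d < y" if "x < y" for x y
    using D(2)[of "{x<..<y}"] dense[OF that] by auto
  have AE_eq: "AE w0 in P0. emeasure (\<mu> w0) A = emeasure (distr P1 (BT T) (\<lambda>y. \<tau> (w0, y))) A"
    if A[measurable]: "A \<in> sets (BT T)" for A
  proof -
    let ?f = "\<lambda>w0. emeasure (\<mu> w0) A"
    let ?g = "\<lambda>w0. emeasure (distr P1 (BT T) (\<lambda>y. \<tau> (w0, y))) A"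
    have f[measurable]: "?f \<in> borel_measurable P0"
      using measurable_compose[OF measurable_prob_algebraD[OF \<mu>[unfolded PT_def]]
        measurable_emeasure_subprob_algebra[OF A]] .
    have g_eq: "?g w0 = (\<integral>\<^sup>+y. indicator A (\<tau> (w0, y)) \<partial>P1)" if "w0 \<in> space P0" for w0
    proof -
      have "(\<lambda>y. \<tau> (w0, y)) \<in> P1 \<rightarrow>\<^sub>M BT T" using that by measurable
      then show ?thesis
        by (simp add: nn_integral_distr flip: nn_integral_indicator)
    qed
    have "(\<lambda>w0. \<integral>\<^sup>+y. indicator A (\<tau> (w0, y)) \<partial>P1) \<in> borel_measurable P0" by measurable
    then have g[measurable]: "?g \<in> borel_measurable P0"
      using g_eq by (subst measurable_cong) auto
    \<comment> \<open>The defining identity of \<open>cond_law\<close>, read for all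
      \<open>B\<close> with \<open>A\<close> fixed, says that both functions are densities of one
      finite measure; uniqueness of densities then gives equality almost everywhere.\<close>
    have "density P0 ?f = density P0 ?g"
    proof (rule measure_eqI)
      fix B assume "B \<in> sets (density P0 ?f)"
      then have B[measurable]: "B \<in> sets P0" by simp
      have "emeasure (density P0 ?f) B = (\<integral>\<^sup>+ w0. indicator B w0 * emeasure (\<mu> w0) A \<partial>P0)"
        by (simp add: emeasure_density mult.commute)
      also have "\<dots> = emeasure (P0 \<Otimes>\<^sub>M P1) {w \<in> space (P0 \<Otimes>\<^sub>M P1). \<tau> w \<in> A \<and> fst w \<in> B}"
        using cl A B unfolding cond_law_def by blast
      also have "\<dots> = (\<integral>\<^sup>+ w. indicator {w \<in> space (P0 \<Otimes>\<^sub>M P1). \<tau> w \<in> A \<and> fst w \<in> B} w \<partial>(P0 \<Otimes>\<^sub>M P1))"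
        by (subst nn_integral_indicator) simp_all
      also have "\<dots> = (\<integral>\<^sup>+ w. indicator B (fst w) * indicator A (\<tau> w) \<partial>(P0 \<Otimes>\<^sub>M P1))"
        by (rule nn_integral_cong) (auto simp: indicator_def)
      also have "\<dots> = (\<integral>\<^sup>+ w0. \<integral>\<^sup>+ y. indicator B w0 * indicator A (\<tau> (w0, y)) \<partial>P1 \<partial>P0)"
        by (subst P1.nn_integral_fst[symmetric]) simp_all
      also have "\<dots> = (\<integral>\<^sup>+ w0. ?g w0 * indicator B w0 \<partial>P0)"
        by (intro nn_integral_cong) (simp add: g_eq nn_integral_cmult mult.commute)
      also have "\<dots> = emeasure (density P0 ?g) B"
        by (simp add: emeasure_density)
      finally show "emeasure (density P0 ?f) B = emeasure (density P0 ?g) B" .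
    qed simp
    then show ?thesis
      using P0.density_unique_iff[OF f g] by simp
  qed
  \<comment> \<open>The exceptional null set depends on the half-line; countability of
    \<open>D\<close> allows a common one.\<close>
  have "AE w0 in P0. \<forall>d\<in>D. emeasure (\<mu> w0) (T \<inter> {..<d}) =
      emeasure (distr P1 (BT T) (\<lambda>y. \<tau> (w0, y))) (T \<inter> {..<d})"
    using D(1) by (subst AE_ball_countable) (auto intro!: AE_eq[unfolded BT_def] simp: BT_def sets_restrict_space)
  with AE_space show ?thesis
  proof eventually_elim
    case (elim w0)
    have "\<mu> w0 \<in> space (PT T)" using measurable_space[OF \<mu>] elim by simp
    moreover have "(\<lambda>y. \<tau> (w0, y)) \<in> P1 \<rightarrow>\<^sub>M BT T" using elim by measurable
    then have "prob_space (distr P1 (BT T) (\<lambda>y. \<tau> (w0, y)))" by (rule P1.prob_space_distr)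
    ultimately show ?case
      using elim by (intro prob_measure_eqI_dense[OF dense_D D(1)]) (auto simp: space_PT)
  qed
qed

lemma measurable_agent: "i \<ge> 1 \<Longrightarrow> (\<lambda>x. (fst x, snd x i)) \<in> Obar P0 P1 \<rightarrow>\<^sub>M P0 \<Otimes>\<^sub>M P1"
  unfolding Obar_def by measurable

section \<open>Empirical measures under a deviation of one agent, and the law of large
  numbers\<close>

text \<open>Here \<open>\<tau>\<close> is any measurable time and \<open>\<mu>\<close> any version
  of its conditional law, so that the limit estimates can be applied to two different versions in
  the final argument.\<close>

locale mean_field_limit =
  P0: prob_space P0 + P1: prob_space P1
  for P0 :: "'a measure" and P1 :: "'b measure" +
  fixes T :: "ennreal set" and F :: "'a \<Rightarrow> 'b \<Rightarrow> ennreal measure \<Rightarrow> ennreal \<Rightarrow> real"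
    and \<tau> :: "'a \<times> 'b \<Rightarrow> ennreal" and \<mu> :: "'a \<Rightarrow> ennreal measure"
  assumes assumptionA: "assumptionA T P0 P1 F"
    and \<tau> [measurable]: "\<tau> \<in> P0 \<Otimes>\<^sub>M P1 \<rightarrow>\<^sub>M BT T"
    and cond_law: "cond_law T P0 P1 \<tau> \<mu>"
begin

sublocale pair_prob_space P0 P1 ..

definition others :: "nat \<Rightarrow> (nat \<Rightarrow> 'b) measure" where
  "others i = (\<Pi>\<^sub>M k\<in>{1..} - {i}. P1)"

text \<open>The time of agent \<open>i\<close> enters as a free value \<open>s\<close>: one estimate
  then covers both a deviation of agent \<open>i\<close> and following
  \<open>\<tau>\<close>.\<close>

definition emp :: "nat \<Rightarrow> nat \<Rightarrow> 'a \<Rightarrow> ennreal \<Rightarrow> (nat \<Rightarrow> 'b) \<Rightarrow> ennreal measure" where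
  "emp n i w0 s v = empirical T n (\<lambda>k. if k = i then s else \<tau> (w0, v k))"

text \<open>\<open>enn2real\<close> sends an infinite supremum to 0, so this bounds the rewards only
  almost everywhere, namely where the supremum is finite.\<close>

definition dominator :: "'a \<times> 'b \<Rightarrow> real" where
  "dominator w = enn2real (SUP m\<in>space (PT T). SUP t\<in>T. ennreal \<bar>F (fst w) (snd w) m t\<bar>)"

lemma prob_space_others: "prob_space (others i)"
  unfolding others_def by (intro prob_space_PiM) unfold_locales

lemma measurable_\<mu> [measurable]: "\<mu> \<in> P0 \<rightarrow>\<^sub>M PT T"
  using cond_law by (simp add: cond_law_def)

lemma measurable_F:
  assumes [measurable]: "f \<in> M \<rightarrow>\<^sub>M P0" "g \<in> M \<rightarrow>\<^sub>M P1" "m \<in> M \<rightarrow>\<^sub>M PT T" "s \<in> M \<rightarrow>\<^sub>M BT T"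
  shows "(\<lambda>x. F (f x) (g x) (m x) (s x)) \<in> borel_measurable M"
proof -
  have [measurable]: "(\<lambda>(w0, w1, m, t). F w0 w1 m t) \<in> borel_measurable (P0 \<Otimes>\<^sub>M P1 \<Otimes>\<^sub>M PT T \<Otimes>\<^sub>M BT T)"
    using assumptionA by (simp add: assumptionA_def)
  have "(\<lambda>x. (\<lambda>(w0, w1, m, t). F w0 w1 m t) (f x, g x, m x, s x)) \<in> borel_measurable M"
    by measurable
  then show ?thesis by simp
qed

lemma AE_fst:
  assumes "AE x in P0. Q x" shows "AE w in P0 \<Otimes>\<^sub>M P1. Q (fst w)"
proof -
  have "AE x in distr (P0 \<Otimes>\<^sub>M P1) P0 fst. Q x"
    using assms by (subst P1.distr_pair_fst)
  then show ?thesis by (rule AE_distrD[rotated]) simp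
qed

lemma integrable_dominator: "integrable (P0 \<Otimes>\<^sub>M P1) dominator"
proof (rule integrableI_bounded)
  show "dominator \<in> borel_measurable (P0 \<Otimes>\<^sub>M P1)"
    using assumptionA unfolding assumptionA_def dominator_def by (intro borel_measurable_enn2real) simp
  have "(\<integral>\<^sup>+ w. norm (dominator w) \<partial>(P0 \<Otimes>\<^sub>M P1)) \<le>
      (\<integral>\<^sup>+ w. (SUP m\<in>space (PT T). SUP t\<in>T. ennreal \<bar>F (fst w) (snd w) m t\<bar>) \<partial>(P0 \<Otimes>\<^sub>M P1))"
    by (intro nn_integral_mono) (simp add: dominator_def ennreal_enn2real_if)
  also have "\<dots> < \<infinity>" using assumptionA by (simp add: assumptionA_def)
  finally show "(\<integral>\<^sup>+ w. norm (dominator w) \<partial>(P0 \<Otimes>\<^sub>M P1)) < \<infinity>" .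
qed

lemma dominator_nonneg: "0 \<le> dominator w"
  by (simp add: dominator_def)

lemma AE_abs_F_le_dominator:
  "AE w in P0 \<Otimes>\<^sub>M P1. \<forall>m\<in>space (PT T). \<forall>t\<in>T. \<bar>F (fst w) (snd w) m t\<bar> \<le> dominator w"
proof -
  have "AE w in P0 \<Otimes>\<^sub>M P1. (SUP m\<in>space (PT T). SUP t\<in>T. ennreal \<bar>F (fst w) (snd w) m t\<bar>) \<noteq> \<infinity>"
    using assumptionA unfolding assumptionA_def
    by (intro nn_integral_PInf_AE) (simp_all only: less_top[symmetric] infinity_ennreal_def not_False_eq_True simp_thms)
  then show ?thesis
  proof eventually_elim
    case (elim w)
    let ?H = "SUP m\<in>space (PT T). SUP t\<in>T. ennreal \<bar>F (fst w) (snd w) m t\<bar>"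
    have "\<bar>F (fst w) (snd w) m t\<bar> \<le> dominator w" if "m \<in> space (PT T)" "t \<in> T" for m t
    proof -
      have "ennreal \<bar>F (fst w) (snd w) m t\<bar> \<le> ?H"
        using that by (intro SUP_upper2[of m] SUP_upper2[of t]) auto
      also have "?H = ennreal (dominator w)"
        unfolding dominator_def using elim
        by (intro ennreal_enn2real[symmetric])
          (simp only: less_top[symmetric] infinity_ennreal_def not_False_eq_True)
      finally show ?thesis by (simp add: dominator_nonneg ennreal_le_iff)
    qed
    then show ?case by blast
  qed
qed

lemma deviated_time_in_T:
  assumes "k \<ge> 1" "s \<in> T" "w0 \<in> space P0" "v \<in> space (others i)"
  shows "(if k = i then s else \<tau> (w0, v k)) \<in> T"
proof (cases "k = i")
  case False
  then have "v k \<in> space P1" using assms(1,4) by (auto simp: others_def space_PiM)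
  then have "(w0, v k) \<in> space (P0 \<Otimes>\<^sub>M P1)" using assms(3) by (simp add: space_pair_measure)
  then show ?thesis using measurable_space[OF \<tau>] False by simp
qed (use assms in simp)

lemma emp_in_space_PT:
  assumes "n \<ge> 1" "s \<in> T" "w0 \<in> space P0" "v \<in> space (others i)"
  shows "emp n i w0 s v \<in> space (PT T)"
  unfolding emp_def
proof (rule empirical_in_space_PT[OF assms(1)])
  show "(if k = i then s else \<tau> (w0, v k)) \<in> T" if "k \<in> {1..n}" for k
    using that assms by (intro deviated_time_in_T) auto
qed

lemma measurable_emp:
  assumes "n \<ge> 1" and [measurable]: "f \<in> M \<rightarrow>\<^sub>M P0" "s \<in> M \<rightarrow>\<^sub>M BT T" "g \<in> M \<rightarrow>\<^sub>M others i"
  shows "(\<lambda>x. emp n i (f x) (s x) (g x)) \<in> M \<rightarrow>\<^sub>M PT T"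
  unfolding emp_def
proof (rule measurable_empirical[OF assms(1)])
  fix k assume k: "k \<in> {1..n}"
  show "(\<lambda>x. if k = i then s x else \<tau> (f x, g x k)) \<in> M \<rightarrow>\<^sub>M BT T"
  proof (cases "k = i")
    case False
    then have [measurable]: "(\<lambda>v. v k) \<in> others i \<rightarrow>\<^sub>M P1"
      using k unfolding others_def by (intro measurable_component_singleton) auto
    show ?thesis using False by simp
  qed simp
qed

lemma integral_emp:
  fixes \<phi> :: "ennreal \<Rightarrow> real"
  assumes "\<phi> \<in> borel_measurable (BT T)" "i \<in> {1..n}" "s \<in> T" "w0 \<in> space P0" "v \<in> space (others i)"
  shows "(\<integral>t. \<phi> t \<partial>emp n i w0 s v) = (\<phi> s + (\<Sum>k\<in>{1..n} - {i}. \<phi> (\<tau> (w0, v k)))) / n"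
proof -
  have "(if k = i then s else \<tau> (w0, v k)) \<in> T" if "k \<in> {1..n}" for k
    using that assms by (intro deviated_time_in_T) auto
  then have "(\<integral>t. \<phi> t \<partial>emp n i w0 s v) = (\<Sum>k\<in>{1..n}. \<phi> (if k = i then s else \<tau> (w0, v k))) / n"
    unfolding emp_def using assms by (intro integral_empirical) auto
  also have "(\<Sum>k\<in>{1..n}. \<phi> (if k = i then s else \<tau> (w0, v k))) =
      \<phi> s + (\<Sum>k\<in>{1..n} - {i}. \<phi> (\<tau> (w0, v k)))"
    using assms(2) by (subst sum.remove[of _ i]) (auto intro!: sum.cong)
  finally show ?thesis .
qed

lemma measurable_integral_emp:
  fixes \<phi> :: "ennreal \<Rightarrow> real"
  assumes [measurable]: "\<phi> \<in> borel_measurable (BT T)" and "i \<in> {1..n}" "s \<in> T" and [measurable]: "w0 \<in> space P0"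
  shows "(\<lambda>v. \<integral>t. \<phi> t \<partial>emp n i w0 s v) \<in> borel_measurable (others i)"
proof -
  have "(\<lambda>v. emp n i w0 s v) \<in> others i \<rightarrow>\<^sub>M PT T"
    using assms by (intro measurable_emp) auto
  then have "(\<lambda>v. emp n i w0 s v) \<in> others i \<rightarrow>\<^sub>M subprob_algebra (BT T)"
    unfolding PT_def by (rule measurable_prob_algebraD)
  then show ?thesis
    by (rule measurable_compose[OF _ integral_measurable_subprob_algebra]) fact
qed

text \<open>A deviation of one agent moves the empirical integral of \<open>\<phi>\<close> by only \<open>O(1/n)\<close>, which is why the
  law of large numbers is uniform in the deviating agent \<open>i\<close> and the deviation \<open>s\<close>.\<close>

lemma empirical_law_of_large_numbers:
  fixes \<phi> :: "ennreal \<Rightarrow> real"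
  assumes w0: "w0 \<in> space P0" and \<mu>w0: "\<mu> w0 = distr P1 (BT T) (\<lambda>y. \<tau> (w0, y))"
    and \<phi>: "\<phi> \<in> borel_measurable (BT T)" "bounded (\<phi> ` T)" and "\<delta> > 0" "\<epsilon> > 0"
  shows "\<forall>\<^sub>F n in sequentially. \<forall>i\<in>{1..n}. \<forall>s\<in>T.
    measure (others i) {v \<in> space (others i). \<delta> \<le> \<bar>(\<integral>t. \<phi> t \<partial>emp n i w0 s v) - (\<integral>t. \<phi> t \<partial>\<mu> w0)\<bar>} \<le> \<epsilon>"
proof -
  obtain C where C: "C > 0" "\<And>t. t \<in> T \<Longrightarrow> \<bar>\<phi> t\<bar> \<le> C"
    using \<phi>(2) by (auto simp: bounded_pos)
  have \<tau>w0: "(\<lambda>y. \<tau> (w0, y)) \<in> P1 \<rightarrow>\<^sub>M BT T" using w0 by measurable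
  have \<tau>T: "\<tau> (w0, y) \<in> T" if "y \<in> space P1" for y
    using measurable_space[OF \<tau>w0 that] by simp
  let ?a = "\<integral>t. \<phi> t \<partial>\<mu> w0"
  have a: "?a = (\<integral>y. \<phi> (\<tau> (w0, y)) \<partial>P1)"
    unfolding \<mu>w0 using \<tau>w0 \<phi> by (intro integral_distr) auto
  have meas: "(\<lambda>y. \<phi> (\<tau> (w0, y))) \<in> borel_measurable P1"
    using measurable_compose[OF \<tau>w0 \<phi>(1)] .
  have bnd: "\<bar>\<phi> (\<tau> (w0, y))\<bar> \<le> C" if "y \<in> space P1" for y
    using C(2) \<tau>T that by blast
  have int: "integrable P1 (\<lambda>y. \<phi> (\<tau> (w0, y)))"
    using meas bnd by (intro P1.integrable_const_bound[where B=C] AE_I2) auto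
  have "(\<integral>y. \<phi> (\<tau> (w0, y)) \<partial>P1) \<le> C" "-C \<le> (\<integral>y. \<phi> (\<tau> (w0, y)) \<partial>P1)"
    by (intro P1.integral_le_const P1.integral_ge_const int AE_I2, use bnd in force)+
  then have abs_a: "\<bar>?a\<bar> \<le> C" unfolding a by (simp add: abs_le_iff)
  \<comment> \<open>This is Hoeffding's bound at the threshold \<open>n * \<delta> / 2\<close>, with
    the number of summands rounded up to \<open>n\<close>.\<close>
  have "(\<lambda>n. 2 * exp (- (real n * \<delta>\<^sup>2 / (8 * C\<^sup>2)))) \<longlonglongrightarrow> 0"
    using C \<open>\<delta> > 0\<close> by real_asymp
  then have "\<forall>\<^sub>F n in sequentially. 2 * exp (- (real n * \<delta>\<^sup>2 / (8 * C\<^sup>2))) < \<epsilon>"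
    using \<open>\<epsilon> > 0\<close> by (rule order_tendstoD)
  \<comment> \<open>The deviating agent shifts the centred sum by at most \<open>2 * C\<close>; from
    here on this uses up at most half of \<open>n * \<delta>\<close>.\<close>
  moreover have "\<forall>\<^sub>F n in sequentially. real n * \<delta> \<ge> 4 * C"
    using \<open>\<delta> > 0\<close> by real_asymp
  \<comment> \<open>At least one opponent must remain, since the concentration bound requires a
    nonempty index set.\<close>
  moreover have "\<forall>\<^sub>F n in sequentially. n \<ge> (2 :: nat)"
    by (rule eventually_ge_at_top)
  ultimately show ?thesis
  proof eventually_elim
    case (elim n)
    then have n: "n \<ge> 2" and nC: "4 * C \<le> n * \<delta>" by simp_all
    show ?case
    proof (intro ballI)
      fix i s assume i: "i \<in> {1..n}" and s: "s \<in> T"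
      interpret Q: prob_space "others i" by (rule prob_space_others)
      define J where "J = {1..n} - {i}"
      have J: "finite J" "J \<subseteq> {1..} - {i}" by (auto simp: J_def)
      have card: "real (card J) = real n - 1" using i n by (simp add: J_def of_nat_diff)
      \<comment> \<open>This event does not mention \<open>s\<close>, and its probability depends on
        \<open>i\<close> only through the number of opponents; the uniformity comes from
        here.\<close>
      let ?E = "{v \<in> space (others i). n * \<delta> / 2 \<le>
        \<bar>(\<Sum>k\<in>J. \<phi> (\<tau> (w0, v k))) - card J * (\<integral>y. \<phi> (\<tau> (w0, y)) \<partial>P1)\<bar>}"
      have comp [measurable]: "(\<lambda>v. v k) \<in> others i \<rightarrow>\<^sub>M P1" if "k \<in> J" for k
        using that J unfolding others_def by (intro measurable_component_singleton) auto
      have "(\<lambda>v. \<phi> (\<tau> (w0, v k))) \<in> borel_measurable (others i)" if "k \<in> J" for k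
        using measurable_compose[OF comp[OF that] meas] .
      then have [measurable]: "(\<lambda>v. \<Sum>k\<in>J. \<phi> (\<tau> (w0, v k))) \<in> borel_measurable (others i)"
        by (rule borel_measurable_sum)
      have "measure (others i) {v \<in> space (others i). \<delta> \<le> \<bar>(\<integral>t. \<phi> t \<partial>emp n i w0 s v) - ?a\<bar>}
          \<le> measure (others i) ?E"
      proof (rule Q.finite_measure_mono)
        show "?E \<in> sets (others i)" by measurable
        show "{v \<in> space (others i). \<delta> \<le> \<bar>(\<integral>t. \<phi> t \<partial>emp n i w0 s v) - ?a\<bar>} \<subseteq> ?E"
        proof safe
          fix v assume v: "v \<in> space (others i)" and "\<delta> \<le> \<bar>(\<integral>t. \<phi> t \<partial>emp n i w0 s v) - ?a\<bar>"
          let ?S = "\<Sum>k\<in>J. \<phi> (\<tau> (w0, v k))"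
          have "\<delta> \<le> \<bar>(\<phi> s + ?S) / n - ?a\<bar>"
            using \<open>\<delta> \<le> _\<close> integral_emp[OF \<phi>(1) i s w0 v] by (simp add: J_def)
          then have "n * \<delta> \<le> n * \<bar>(\<phi> s + ?S) / n - ?a\<bar>" by (intro mult_left_mono) auto
          also have "\<dots> = \<bar>n * ((\<phi> s + ?S) / n - ?a)\<bar>" by (simp add: abs_mult)
          \<comment> \<open>Of the \<open>n\<close> copies of the mean, one is paired with the
            deviator and the other \<open>n - 1\<close> centre the sum over the opponents.\<close>
          also have "n * ((\<phi> s + ?S) / n - ?a) = (\<phi> s - ?a) + (?S - card J * ?a)"
            using n by (simp add: card right_diff_distrib left_diff_distrib)
          also have "\<bar>\<dots>\<bar> \<le> 2 * C + \<bar>?S - card J * ?a\<bar>"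
            using C(2)[OF s] abs_a by linarith
          finally show "n * \<delta> / 2 \<le> \<bar>?S - card J * (\<integral>y. \<phi> (\<tau> (w0, y)) \<partial>P1)\<bar>"
            using nC unfolding a by simp
        qed
      qed
      also have "\<dots> \<le> 2 * exp (- (n * \<delta> / 2)\<^sup>2 / (2 * C\<^sup>2 * card J))"
        unfolding others_def
      proof (rule PiM_concentration)
        show "J \<noteq> {}" using card n by auto
        show "prob_space P1" by (rule P1.prob_space_axioms)
        show "\<bar>\<phi> (\<tau> (w0, y))\<bar> \<le> C" if "y \<in> space P1" for y
          using that by (rule bnd)
        show "0 \<le> n * \<delta> / 2" using \<open>\<delta> > 0\<close> by simp
      qed (use meas C(1) J in simp_all)
      also have "\<dots> \<le> 2 * exp (- (real n * \<delta>\<^sup>2 / (8 * C\<^sup>2)))"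
      proof -
        have "real n * \<delta>\<^sup>2 / (8 * C\<^sup>2) = (n * \<delta> / 2)\<^sup>2 / (2 * C\<^sup>2 * n)"
          using n C(1) by (simp add: power_divide power_mult_distrib) (simp add: power2_eq_square)
        also have "\<dots> \<le> (n * \<delta> / 2)\<^sup>2 / (2 * C\<^sup>2 * card J)"
        proof (rule divide_left_mono)
          show "2 * C\<^sup>2 * card J \<le> 2 * C\<^sup>2 * n"
            unfolding card by (intro mult_left_mono) auto
          have "real (card J) > 0" "real n > 0" using card n by auto
          then show "0 < 2 * C\<^sup>2 * n * (2 * C\<^sup>2 * card J)"
            using C(1) by (intro mult_pos_pos) auto
        qed simp
        finally show ?thesis by simp
      qed
      also have "\<dots> \<le> \<epsilon>" using elim by simp
      finally show "measure (others i) {v \<in> space (others i). \<delta> \<le> \<bar>(\<integral>t. \<phi> t \<partial>emp n i w0 s v) - ?a\<bar>} \<le> \<epsilon>" .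
    qed
  qed
qed

section \<open>The reward gap between the empirical measure and the conditional law\<close>

definition gap :: "nat \<Rightarrow> nat \<Rightarrow> 'a \<times> 'b \<Rightarrow> ennreal \<Rightarrow> (nat \<Rightarrow> 'b) \<Rightarrow> real" where
  "gap n i w s v = \<bar>F (fst w) (snd w) (emp n i (fst w) s v) s - F (fst w) (snd w) (\<mu> (fst w)) s\<bar>"

text \<open>The inner integral is a conditional expectation given the common noise and the noise of
  agent \<open>i\<close>. Keeping the integrals iterated lets dominated convergence act on the outer
  one alone.\<close>

definition mean_gap :: "nat \<Rightarrow> nat \<Rightarrow> ('a \<times> 'b \<Rightarrow> ennreal) \<Rightarrow> real" where
  "mean_gap n i \<sigma> = (\<integral>w. \<integral>v. gap n i w (\<sigma> w) v \<partial>others i \<partial>(P0 \<Otimes>\<^sub>M P1))"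

lemma gap_nonneg: "0 \<le> gap n i w s v"
  by (simp add: gap_def)

lemma \<mu>_in_space_PT: "w0 \<in> space P0 \<Longrightarrow> \<mu> w0 \<in> space (PT T)"
  using measurable_space[OF measurable_\<mu>] .

lemma gap_le:
  assumes bound: "\<forall>m\<in>space (PT T). \<forall>t\<in>T. \<bar>F (fst w) (snd w) m t\<bar> \<le> dominator w"
    and "n \<ge> 1" "s \<in> T" "w \<in> space (P0 \<Otimes>\<^sub>M P1)" "v \<in> space (others i)"
  shows "gap n i w s v \<le> 2 * dominator w"
proof -
  have w0: "fst w \<in> space P0" using assms(4) by (auto simp: space_pair_measure)
  have "\<bar>F (fst w) (snd w) (emp n i (fst w) s v) s\<bar> \<le> dominator w"
    using bound emp_in_space_PT[OF assms(2,3) w0 assms(5)] assms(3) by blast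
  moreover have "\<bar>F (fst w) (snd w) (\<mu> (fst w)) s\<bar> \<le> dominator w"
    using bound \<mu>_in_space_PT[OF w0] assms(3) by blast
  ultimately show ?thesis unfolding gap_def by linarith
qed

lemma measurable_gap:
  assumes "n \<ge> 1" and [measurable]: "\<sigma> \<in> P0 \<Otimes>\<^sub>M P1 \<rightarrow>\<^sub>M BT T"
  shows "(\<lambda>(w, v). gap n i w (\<sigma> w) v) \<in> borel_measurable ((P0 \<Otimes>\<^sub>M P1) \<Otimes>\<^sub>M others i)"
proof -
  have [measurable]: "(\<lambda>x. emp n i (fst (fst x)) (\<sigma> (fst x)) (snd x)) \<in>
      (P0 \<Otimes>\<^sub>M P1) \<Otimes>\<^sub>M others i \<rightarrow>\<^sub>M PT T"
    by (intro measurable_emp assms) measurable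
  have [measurable]: "(\<lambda>x. F (fst (fst x)) (snd (fst x)) (emp n i (fst (fst x)) (\<sigma> (fst x)) (snd x)) (\<sigma> (fst x)))
      \<in> borel_measurable ((P0 \<Otimes>\<^sub>M P1) \<Otimes>\<^sub>M others i)"
    by (intro measurable_F) measurable
  have [measurable]: "(\<lambda>x. F (fst (fst x)) (snd (fst x)) (\<mu> (fst (fst x))) (\<sigma> (fst x)))
      \<in> borel_measurable ((P0 \<Otimes>\<^sub>M P1) \<Otimes>\<^sub>M others i)"
    by (intro measurable_F) measurable
  show ?thesis unfolding gap_def case_prod_beta by measurable
qed

text \<open>If every test integral is within \<open>\<delta>\<close> of its limit, continuity bounds
  the gap by \<open>\<eta> / 2\<close>. Otherwise the gap is at most twice the dominator, and a
  union bound over the finitely many test functions makes this case improbable, uniformly in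
  \<open>i\<close> and \<open>s\<close>.\<close>

lemma conditional_gap_small:
  assumes w: "w \<in> space (P0 \<Otimes>\<^sub>M P1)"
    and \<mu>w: "\<mu> (fst w) = distr P1 (BT T) (\<lambda>y. \<tau> (fst w, y))"
    and lim: "limitin euclidean (\<lambda>m. SUP t\<in>T. ereal \<bar>F (fst w) (snd w) m t - F (fst w) (snd w) (\<mu> (fst w)) t\<bar>)
          0 (atin (tau_topology T) (\<mu> (fst w)))"
    and bound: "\<forall>m\<in>space (PT T). \<forall>t\<in>T. \<bar>F (fst w) (snd w) m t\<bar> \<le> dominator w"
    and "\<eta> > 0"
  shows "\<forall>\<^sub>F n in sequentially. \<forall>i\<in>{1..n}. \<forall>s\<in>T. (\<integral>v. gap n i w s v \<partial>others i) \<le> \<eta>"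
proof -
  have w0: "fst w \<in> space P0" using w by (auto simp: space_pair_measure)
  let ?m0 = "\<mu> (fst w)"
  obtain \<Phi> :: "(ennreal \<Rightarrow> real) set" and \<delta> where fin: "finite \<Phi>"
    and \<Phi>: "\<And>\<phi>. \<phi> \<in> \<Phi> \<Longrightarrow> \<phi> \<in> borel_measurable (BT T)" "\<And>\<phi>. \<phi> \<in> \<Phi> \<Longrightarrow> bounded (\<phi> ` T)" and "\<delta> > 0"
    and nbhd: "\<And>m t. m \<in> space (PT T) \<Longrightarrow> (\<And>\<phi>. \<phi> \<in> \<Phi> \<Longrightarrow> \<bar>(\<integral>t. \<phi> t \<partial>m) - (\<integral>t. \<phi> t \<partial>?m0)\<bar> < \<delta>) \<Longrightarrow> t \<in> T \<Longrightarrow>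
      \<bar>F (fst w) (snd w) m t - F (fst w) (snd w) ?m0 t\<bar> \<le> \<eta> / 2"
    using tau_continuous_neighbourhood[OF lim \<mu>_in_space_PT[OF w0], of "\<eta> / 2"] \<open>\<eta> > 0\<close> by force
  define K where "K = 2 * dominator w"
  have K: "K \<ge> 0" by (simp add: K_def dominator_nonneg)
  \<comment> \<open>Chosen so that \<open>card \<Phi>\<close> bad events, each costing at most
    \<open>K\<close>, contribute no more than \<open>\<eta> / 2\<close>. The added ones keep the
    denominator positive when \<open>K = 0\<close> or \<open>\<Phi>\<close> is empty.\<close>
  define e where "e = \<eta> / (2 * (K + 1) * (card \<Phi> + 1))"
  have "e > 0" unfolding e_def using \<open>\<eta> > 0\<close> K by (intro divide_pos_pos mult_pos_pos) auto
  have Ke: "K * (card \<Phi> * e) \<le> \<eta> / 2"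
  proof -
    have "K * (card \<Phi> * e) \<le> (K + 1) * ((card \<Phi> + 1) * e)"
      using K \<open>e > 0\<close> by (intro mult_mono) auto
    also have "\<dots> = \<eta> / 2" unfolding e_def using K by (simp add: divide_simps)
    finally show ?thesis .
  qed
  define Bad where "Bad n i s \<phi> = {v \<in> space (others i).
    \<delta> \<le> \<bar>(\<integral>t. \<phi> t \<partial>emp n i (fst w) s v) - (\<integral>t. \<phi> t \<partial>?m0)\<bar>}" for n i s and \<phi> :: "ennreal \<Rightarrow> real"
  have "\<forall>\<^sub>F n in sequentially. \<forall>\<phi>\<in>\<Phi>. \<forall>i\<in>{1..n}. \<forall>s\<in>T. measure (others i) (Bad n i s \<phi>) \<le> e"
    unfolding Bad_def using fin \<Phi> \<open>\<delta> > 0\<close> \<open>e > 0\<close>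
    by (intro eventually_ball_finite ballI empirical_law_of_large_numbers w0 \<mu>w) auto
  then show ?thesis
    using eventually_ge_at_top[of 1]
  proof eventually_elim
    case (elim n)
    show ?case
    proof (intro ballI)
      fix i s assume i: "i \<in> {1..n}" and s: "s \<in> T"
      interpret Q: prob_space "others i" by (rule prob_space_others)
      have Bad [measurable]: "Bad n i s \<phi> \<in> sets (others i)" if "\<phi> \<in> \<Phi>" for \<phi>
      proof -
        have [measurable]: "(\<lambda>v. \<integral>t. \<phi> t \<partial>emp n i (fst w) s v) \<in> borel_measurable (others i)"
          using \<Phi>(1)[OF that] i s w0 by (rule measurable_integral_emp)
        show ?thesis unfolding Bad_def by measurable
      qed
      \<comment> \<open>A pointwise form of the union bound: the sum of indicators is at least 1 as
        soon as one test function fails.\<close>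
      let ?g = "\<lambda>v. \<eta> / 2 + K * (\<Sum>\<phi>\<in>\<Phi>. indicator (Bad n i s \<phi>) v)"
      have int: "integrable (others i) (indicator (Bad n i s \<phi>) :: _ \<Rightarrow> real)" if "\<phi> \<in> \<Phi>" for \<phi>
        using Bad[OF that] Q.emeasure_finite by (simp add: less_top[symmetric])
      have "(\<integral>v. gap n i w s v \<partial>others i) \<le> (\<integral>v. ?g v \<partial>others i)"
      proof (rule integral_mono')
        show "integrable (others i) ?g"
          using int by (intro Bochner_Integration.integrable_add integrable_mult_right
            Bochner_Integration.integrable_sum) auto
        fix v assume v: "v \<in> space (others i)"
        show "0 \<le> ?g v" using K \<open>\<eta> > 0\<close> by (intro add_nonneg_nonneg mult_nonneg_nonneg sum_nonneg) auto
        show "gap n i w s v \<le> ?g v"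
        proof (cases "\<exists>\<phi>\<in>\<Phi>. v \<in> Bad n i s \<phi>")
          case True
          then obtain \<phi> where \<phi>: "\<phi> \<in> \<Phi>" "v \<in> Bad n i s \<phi>" by blast
          have "(1::real) \<le> (\<Sum>\<phi>\<in>\<Phi>. indicator (Bad n i s \<phi>) v)"
            using member_le_sum[OF \<phi>(1), of "\<lambda>\<phi>. indicator (Bad n i s \<phi>) v :: real"] fin \<phi>(2) by simp
          then have "K \<le> K * (\<Sum>\<phi>\<in>\<Phi>. indicator (Bad n i s \<phi>) v)"
            using K mult_left_mono[of 1 _ K] by simp
          moreover have "gap n i w s v \<le> K"
            unfolding K_def by (rule gap_le[OF bound elim(2) s w v])
          ultimately show ?thesis using \<open>\<eta> > 0\<close> by linarith
        next
          case False
          then have "gap n i w s v \<le> \<eta> / 2"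
            unfolding gap_def using v s
            by (intro nbhd emp_in_space_PT[OF elim(2) s w0 v]) (force simp: Bad_def)+
          moreover have "0 \<le> K * (\<Sum>\<phi>\<in>\<Phi>. indicator (Bad n i s \<phi>) v)"
            using K by (intro mult_nonneg_nonneg sum_nonneg) auto
          ultimately show ?thesis by linarith
        qed
      qed
      also have "\<dots> = \<eta> / 2 + K * (\<Sum>\<phi>\<in>\<Phi>. measure (others i) (Bad n i s \<phi>))"
      proof -
        have "(\<integral>v. ?g v \<partial>others i) = \<eta> / 2 + (\<integral>v. K * (\<Sum>\<phi>\<in>\<Phi>. indicator (Bad n i s \<phi>) v) \<partial>others i)"
          using int by (subst Bochner_Integration.integral_add) (auto simp: Q.prob_space)
        also have "(\<integral>v. K * (\<Sum>\<phi>\<in>\<Phi>. indicator (Bad n i s \<phi>) v) \<partial>others i) =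
            K * (\<Sum>\<phi>\<in>\<Phi>. \<integral>v. indicator (Bad n i s \<phi>) v \<partial>others i)"
          using int by (simp add: Bochner_Integration.integral_sum)
        also have "(\<Sum>\<phi>\<in>\<Phi>. \<integral>v. indicator (Bad n i s \<phi>) v \<partial>others i) = (\<Sum>\<phi>\<in>\<Phi>. measure (others i) (Bad n i s \<phi>))"
          using Bad by (intro sum.cong) auto
        finally show ?thesis .
      qed
      also have "\<dots> \<le> \<eta> / 2 + K * (card \<Phi> * e)"
        using K elim(1) i s by (intro add_left_mono mult_left_mono sum_bounded_above) auto
      also have "\<dots> \<le> \<eta>" using Ke by simp
      finally show "(\<integral>v. gap n i w s v \<partial>others i) \<le> \<eta>" .
    qed
  qed
qed

text \<open>The continuity assumption is applied at the random point \<open>\<mu> (fst w)\<close>.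
  This is legitimate because its exceptional null set is common to all \<open>m0\<close>.\<close>

lemma AE_conditional_gap_small:
  "AE w in P0 \<Otimes>\<^sub>M P1. \<forall>\<eta>>0. \<forall>\<^sub>F n in sequentially. \<forall>i\<in>{1..n}. \<forall>s\<in>T. (\<integral>v. gap n i w s v \<partial>others i) \<le> \<eta>"
proof -
  have "AE w in P0 \<Otimes>\<^sub>M P1. \<mu> (fst w) = distr P1 (BT T) (\<lambda>y. \<tau> (fst w, y))"
    using cond_law_AE_eq[OF P0.prob_space_axioms P1.prob_space_axioms \<tau> cond_law] by (rule AE_fst)
  moreover have "AE w in P0 \<Otimes>\<^sub>M P1. \<forall>m0\<in>space (PT T).
        limitin euclidean (\<lambda>m. SUP t\<in>T. ereal \<bar>F (fst w) (snd w) m t - F (fst w) (snd w) m0 t\<bar>)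
          0 (atin (tau_topology T) m0)"
    using assumptionA unfolding assumptionA_def by (elim conjE)
  ultimately show ?thesis
    using AE_abs_F_le_dominator AE_space
  proof eventually_elim
    case (elim w)
    have "fst w \<in> space P0" using elim(4) by (auto simp: space_pair_measure)
    then show ?case
      using conditional_gap_small[OF elim(4) elim(1) _ elim(3)] elim(2) \<mu>_in_space_PT by blast
  qed
qed

lemma measurable_integral_gap:
  assumes "n \<ge> 1" "\<sigma> \<in> P0 \<Otimes>\<^sub>M P1 \<rightarrow>\<^sub>M BT T"
  shows "(\<lambda>w. \<integral>v. gap n i w (\<sigma> w) v \<partial>others i) \<in> borel_measurable (P0 \<Otimes>\<^sub>M P1)"
proof -
  interpret Q: prob_space "others i" by (rule prob_space_others)
  show ?thesis
    by (rule Q.borel_measurable_lebesgue_integral[OF measurable_gap[OF assms]])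
qed

lemma AE_integral_gap_le:
  assumes "n \<ge> 1" "\<sigma> \<in> P0 \<Otimes>\<^sub>M P1 \<rightarrow>\<^sub>M BT T"
  shows "AE w in P0 \<Otimes>\<^sub>M P1. (\<integral>v. gap n i w (\<sigma> w) v \<partial>others i) \<le> 2 * dominator w"
  using AE_abs_F_le_dominator AE_space
proof eventually_elim
  case (elim w)
  interpret Q: prob_space "others i" by (rule prob_space_others)
  have "\<sigma> w \<in> T" using measurable_space[OF assms(2) elim(2)] by simp
  then have "(\<integral>v. gap n i w (\<sigma> w) v \<partial>others i) \<le> (\<integral>v. 2 * dominator w \<partial>others i)"
    using elim assms(1) by (intro integral_mono') (auto intro: gap_le simp: dominator_nonneg)
  then show ?case by (simp add: Q.prob_space)
qed

lemma integral_gap_nonneg: "0 \<le> (\<integral>v. gap n i w s v \<partial>others i)"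
  by (simp add: gap_nonneg)

text \<open>A bound free of \<open>n\<close>, \<open>i\<close> and \<open>\<sigma>\<close>, which
  makes the supremum defining the rate finite.\<close>

lemma mean_gap_le:
  assumes "n \<ge> 1" "\<sigma> \<in> P0 \<Otimes>\<^sub>M P1 \<rightarrow>\<^sub>M BT T"
  shows "mean_gap n i \<sigma> \<le> (\<integral>w. 2 * dominator w \<partial>(P0 \<Otimes>\<^sub>M P1))"
  unfolding mean_gap_def
proof (rule integral_mono_AE)
  show int: "integrable (P0 \<Otimes>\<^sub>M P1) (\<lambda>w. 2 * dominator w)"
    using integrable_dominator by (rule integrable_mult_right)
  show "AE w in P0 \<Otimes>\<^sub>M P1. (\<integral>v. gap n i w (\<sigma> w) v \<partial>others i) \<le> 2 * dominator w"
    by (rule AE_integral_gap_le[OF assms])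
  then have "AE w in P0 \<Otimes>\<^sub>M P1. norm (\<integral>v. gap n i w (\<sigma> w) v \<partial>others i) \<le> norm (2 * dominator w)"
    by eventually_elim (simp add: integral_gap_nonneg dominator_nonneg)
  with int measurable_integral_gap[OF assms]
  show "integrable (P0 \<Otimes>\<^sub>M P1) (\<lambda>w. \<integral>v. gap n i w (\<sigma> w) v \<partial>others i)"
    by (rule Bochner_Integration.integrable_bound)
qed

text \<open>Dominated convergence with twice the dominator. Both the agent and the time may vary
  with \<open>n\<close>, which is what turns this statement about sequences into a uniform
  one.\<close>

lemma mean_gap_tendsto_0:
  assumes i: "\<And>n. n \<ge> 1 \<Longrightarrow> i n \<in> {1..n}" and \<sigma>: "\<And>n. \<sigma> n \<in> P0 \<Otimes>\<^sub>M P1 \<rightarrow>\<^sub>M BT T"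
  shows "(\<lambda>n. mean_gap n (i n) (\<sigma> n)) \<longlonglongrightarrow> 0"
\<comment> \<open>The index is shifted because with no players the empirical measure is not a
  probability measure and the bounds fail to apply.\<close>
proof (rule LIMSEQ_imp_Suc)
  have "(\<lambda>n. \<integral>w. \<integral>v. gap (Suc n) (i (Suc n)) w (\<sigma> (Suc n) w) v \<partial>others (i (Suc n)) \<partial>(P0 \<Otimes>\<^sub>M P1))
      \<longlonglongrightarrow> (\<integral>w. 0 \<partial>(P0 \<Otimes>\<^sub>M P1))"
  proof (rule integral_dominated_convergence[where w = "\<lambda>w. 2 * dominator w"])
    show "(\<lambda>w. \<integral>v. gap (Suc n) (i (Suc n)) w (\<sigma> (Suc n) w) v \<partial>others (i (Suc n)))
        \<in> borel_measurable (P0 \<Otimes>\<^sub>M P1)" for n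
      by (intro measurable_integral_gap \<sigma>) simp
    show "AE w in P0 \<Otimes>\<^sub>M P1. norm (\<integral>v. gap (Suc n) (i (Suc n)) w (\<sigma> (Suc n) w) v \<partial>others (i (Suc n)))
        \<le> 2 * dominator w" for n
      using AE_integral_gap_le[OF _ \<sigma>, of "Suc n" "i (Suc n)" "Suc n"] by (simp add: integral_gap_nonneg)
    show "AE w in P0 \<Otimes>\<^sub>M P1.
        (\<lambda>n. \<integral>v. gap (Suc n) (i (Suc n)) w (\<sigma> (Suc n) w) v \<partial>others (i (Suc n))) \<longlonglongrightarrow> 0"
      using AE_conditional_gap_small AE_space
    proof eventually_elim
      case (elim w)
      have "(\<lambda>n. \<integral>v. gap n (i n) w (\<sigma> n w) v \<partial>others (i n)) \<longlonglongrightarrow> 0"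
      proof (rule tendstoI)
        fix e :: real assume "e > 0"
        then have "\<forall>\<^sub>F n in sequentially. \<forall>i\<in>{1..n}. \<forall>s\<in>T. (\<integral>v. gap n i w s v \<partial>others i) \<le> e / 2"
          using elim(1) by (meson half_gt_zero)
        then show "\<forall>\<^sub>F n in sequentially. dist (\<integral>v. gap n (i n) w (\<sigma> n w) v \<partial>others (i n)) 0 < e"
          using eventually_ge_at_top[of 1]
        proof eventually_elim
          case (elim n)
          have "\<sigma> n w \<in> T" using measurable_space[OF \<sigma> \<open>w \<in> _\<close>] by simp
          then have "(\<integral>v. gap n (i n) w (\<sigma> n w) v \<partial>others (i n)) \<le> e / 2"
            using elim i by blast
          then show ?case
            using \<open>e > 0\<close> integral_gap_nonneg[of "i n" n w "\<sigma> n w"] by (simp add: dist_real_def)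
        qed
      qed
      then show ?case by (rule LIMSEQ_Suc)
    qed
  qed (use integrable_dominator in auto)
  then show "(\<lambda>n. mean_gap (Suc n) (i (Suc n)) (\<sigma> (Suc n))) \<longlonglongrightarrow> 0"
    by (simp add: mean_gap_def)
qed

text \<open>If the bound failed for infinitely many \<open>n\<close>, choosing a violating pair at
  each of them would give a sequence contradicting \<open>mean_gap_tendsto_0\<close>. No
  measurability of a supremum over \<open>\<sigma>\<close> is involved.\<close>

lemma eventually_mean_gap_le:
  assumes "e > 0"
  shows "\<forall>\<^sub>F n in sequentially. \<forall>i\<in>{1..n}. \<forall>\<sigma>\<in>P0 \<Otimes>\<^sub>M P1 \<rightarrow>\<^sub>M BT T. mean_gap n i \<sigma> \<le> e"
proof (rule ccontr)
  assume "\<not> ?thesis"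
  then have freq: "\<exists>\<^sub>F n in sequentially. \<exists>i\<in>{1..n}. \<exists>\<sigma>\<in>P0 \<Otimes>\<^sub>M P1 \<rightarrow>\<^sub>M BT T. e < mean_gap n i \<sigma>"
    by (simp add: not_eventually Bex_def not_le)
  define bad where "bad n p \<longleftrightarrow> fst p \<in> {1..n} \<and> snd p \<in> P0 \<Otimes>\<^sub>M P1 \<rightarrow>\<^sub>M BT T \<and> e < mean_gap n (fst p) (snd p)"
    for n and p :: "nat \<times> ('a \<times> 'b \<Rightarrow> ennreal)"
  \<comment> \<open>Where nothing violates the bound, \<open>(1, \<tau>)\<close> is an admissible
    filler: agent 1 takes part in every game with \<open>n \<ge> 1\<close>.\<close>
  define p where "p n = (if \<exists>p. bad n p then SOME p. bad n p else (1, \<tau>))" for n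
  have bad_p: "bad n (p n)" if "\<exists>p. bad n p" for n
    using someI_ex[OF that] that by (simp add: p_def)
  have "(\<lambda>n. mean_gap n (fst (p n)) (snd (p n))) \<longlonglongrightarrow> 0"
  proof (rule mean_gap_tendsto_0)
    show "fst (p n) \<in> {1..n}" if "n \<ge> 1" for n
      using bad_p[of n] that by (cases "\<exists>p. bad n p") (auto simp: bad_def p_def)
    show "snd (p n) \<in> P0 \<Otimes>\<^sub>M P1 \<rightarrow>\<^sub>M BT T" for n
      using bad_p[of n] by (cases "\<exists>p. bad n p") (auto simp: bad_def p_def)
  qed
  then have "\<forall>\<^sub>F n in sequentially. mean_gap n (fst (p n)) (snd (p n)) < e"
    using \<open>e > 0\<close> by (rule order_tendstoD)
  then have "\<forall>\<^sub>F n in sequentially. \<not> e < mean_gap n (fst (p n)) (snd (p n))"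
    by eventually_elim simp
  moreover from freq have "\<exists>\<^sub>F n in sequentially. e < mean_gap n (fst (p n)) (snd (p n))"
  proof (rule frequently_elim1)
    fix n assume "\<exists>i\<in>{1..n}. \<exists>\<sigma>\<in>P0 \<Otimes>\<^sub>M P1 \<rightarrow>\<^sub>M BT T. e < mean_gap n i \<sigma>"
    then obtain i \<sigma> where "i \<in> {1..n}" "\<sigma> \<in> P0 \<Otimes>\<^sub>M P1 \<rightarrow>\<^sub>M BT T" "e < mean_gap n i \<sigma>" by blast
    then have "bad n (i, \<sigma>)" by (simp add: bad_def)
    then show "e < mean_gap n (fst (p n)) (snd (p n))"
      using bad_p[of n] unfolding bad_def by blast
  qed
  ultimately show False
    by (simp add: frequently_def)
qed

section \<open>Comparison of the game payoff with the mean field payoff\<close>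

text \<open>Reinserting the noise of agent \<open>i\<close> at coordinate \<open>i\<close> rebuilds
  the product space, so this agent's pair of noises is independent of the opponents. The product
  over all agents is split at \<open>i\<close>, and Tonelli, applied to indicators, moves the
  bracket from the idiosyncratic factors to the pair with the common noise.\<close>

lemma Obar_eq_distr:
  assumes "i \<ge> 1"
  shows "Obar P0 P1 = distr ((P0 \<Otimes>\<^sub>M P1) \<Otimes>\<^sub>M others i) (Obar P0 P1) (\<lambda>x. (fst (fst x), (snd x)(i := snd (fst x))))"
    (is "_ = distr _ _ ?h")
proof (rule measure_eqI)
  interpret Q: prob_space "others i" by (rule prob_space_others)
  let ?\<Pi> = "\<Pi>\<^sub>M k\<in>{1..}. P1"
  interpret \<Pi>: prob_space ?\<Pi> by (intro prob_space_PiM P1.prob_space_axioms)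
  have I: "insert i ({1..} - {i}) = {1..}" using assms by auto
  have split: "?\<Pi> = distr (P1 \<Otimes>\<^sub>M others i) ?\<Pi> (\<lambda>p. (snd p)(i := fst p))"
    using distr_pair_PiM_eq_PiM[of "{1..} - {i}" "\<lambda>_. P1" i] P1.prob_space_axioms
    unfolding I others_def case_prod_beta by simp
  have upd: "(\<lambda>x. (snd x)(i := fst x)) \<in> P1 \<Otimes>\<^sub>M others i \<rightarrow>\<^sub>M ?\<Pi>"
    using assms unfolding others_def by (intro measurable_fun_upd[where J = "{1..} - {i}"]) auto
  have h: "?h \<in> (P0 \<Otimes>\<^sub>M P1) \<Otimes>\<^sub>M others i \<rightarrow>\<^sub>M Obar P0 P1"
    unfolding Obar_def
    by (intro measurable_Pair measurable_fun_upd[where J = "{1..} - {i}"])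
      (use assms in \<open>auto simp: others_def\<close>)
  fix X assume "X \<in> sets (Obar P0 P1)"
  then have X [measurable]: "X \<in> sets (P0 \<Otimes>\<^sub>M ?\<Pi>)" by (simp add: Obar_def)
  have "emeasure (Obar P0 P1) X = (\<integral>\<^sup>+x. indicator X x \<partial>(P0 \<Otimes>\<^sub>M ?\<Pi>))"
    unfolding Obar_def by (rule nn_integral_indicator[OF X, symmetric])
  also have "\<dots> = (\<integral>\<^sup>+w0. \<integral>\<^sup>+u. indicator X (w0, u) \<partial>?\<Pi> \<partial>P0)"
    by (rule \<Pi>.nn_integral_fst[symmetric, OF borel_measurable_indicator[OF X]])
  also have "\<dots> = (\<integral>\<^sup>+w0. \<integral>\<^sup>+p. indicator X (w0, (snd p)(i := fst p)) \<partial>(P1 \<Otimes>\<^sub>M others i) \<partial>P0)"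
  proof (rule nn_integral_cong)
    fix w0 assume w0: "w0 \<in> space P0"
    have "(\<lambda>u. indicator X (w0, u) :: ennreal) \<in> borel_measurable ?\<Pi>"
      using measurable_compose[OF measurable_Pair1'[OF w0] borel_measurable_indicator[OF X]] .
    then have "(\<lambda>u. indicator X (w0, u) :: ennreal)
        \<in> borel_measurable (distr (P1 \<Otimes>\<^sub>M others i) ?\<Pi> (\<lambda>p. (snd p)(i := fst p)))"
      by (simp only: measurable_distr_eq1)
    from nn_integral_distr[OF upd this]
    show "(\<integral>\<^sup>+u. indicator X (w0, u) \<partial>?\<Pi>) = (\<integral>\<^sup>+p. indicator X (w0, (snd p)(i := fst p)) \<partial>(P1 \<Otimes>\<^sub>M others i))"
      by (simp only: split[symmetric])
  qed
  also have "\<dots> = (\<integral>\<^sup>+w0. \<integral>\<^sup>+w1. \<integral>\<^sup>+v. indicator X (w0, v(i := w1)) \<partial>others i \<partial>P1 \<partial>P0)"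
  proof (rule nn_integral_cong)
    fix w0 assume w0: "w0 \<in> space P0"
    have "(\<lambda>p. indicator X (w0, (snd p)(i := fst p)) :: ennreal) \<in> borel_measurable (P1 \<Otimes>\<^sub>M others i)"
      using measurable_compose[OF measurable_compose[OF upd measurable_Pair1'[OF w0]] borel_measurable_indicator[OF X]] .
    from Q.nn_integral_fst[OF this, symmetric]
    show "(\<integral>\<^sup>+p. indicator X (w0, (snd p)(i := fst p)) \<partial>(P1 \<Otimes>\<^sub>M others i)) =
        (\<integral>\<^sup>+w1. \<integral>\<^sup>+v. indicator X (w0, v(i := w1)) \<partial>others i \<partial>P1)" by simp
  qed
  also have "\<dots> = (\<integral>\<^sup>+w. \<integral>\<^sup>+v. indicator X (fst w, v(i := snd w)) \<partial>others i \<partial>(P0 \<Otimes>\<^sub>M P1))"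
  proof -
    have "(\<lambda>x. indicator X (?h x) :: ennreal) \<in> borel_measurable ((P0 \<Otimes>\<^sub>M P1) \<Otimes>\<^sub>M others i)"
      using measurable_compose[OF h[unfolded Obar_def] borel_measurable_indicator[OF X]] .
    from Q.borel_measurable_nn_integral_fst[OF this]
    have "(\<lambda>w. \<integral>\<^sup>+v. indicator X (fst w, v(i := snd w)) \<partial>others i) \<in> borel_measurable (P0 \<Otimes>\<^sub>M P1)"
      by simp
    from P1.nn_integral_fst[OF this] show ?thesis by simp
  qed
  also have "\<dots> = (\<integral>\<^sup>+x. indicator X (?h x) \<partial>((P0 \<Otimes>\<^sub>M P1) \<Otimes>\<^sub>M others i))"
  proof -
    have "(\<lambda>x. indicator X (?h x) :: ennreal) \<in> borel_measurable ((P0 \<Otimes>\<^sub>M P1) \<Otimes>\<^sub>M others i)"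
      using measurable_compose[OF h[unfolded Obar_def] borel_measurable_indicator[OF X]] .
    from Q.nn_integral_fst[OF this] show ?thesis by simp
  qed
  also have "\<dots> = (\<integral>\<^sup>+x. indicator X x \<partial>distr ((P0 \<Otimes>\<^sub>M P1) \<Otimes>\<^sub>M others i) (Obar P0 P1) ?h)"
    by (rule nn_integral_distr[OF h, symmetric])
      (simp only: measurable_distr_eq1 Obar_def borel_measurable_indicator[OF X])
  also have "\<dots> = emeasure (distr ((P0 \<Otimes>\<^sub>M P1) \<Otimes>\<^sub>M others i) (Obar P0 P1) ?h) X"
    by (rule nn_integral_indicator) (simp only: sets_distr Obar_def X)
  finally show "emeasure (Obar P0 P1) X = emeasure (distr ((P0 \<Otimes>\<^sub>M P1) \<Otimes>\<^sub>M others i) (Obar P0 P1) ?h) X" .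
qed simp

abbreviation profile :: "nat \<Rightarrow> 'a \<times> (nat \<Rightarrow> 'b) \<Rightarrow> ennreal" where
  "profile \<equiv> \<lambda>k w. \<tau> (fst w, snd w k)"

text \<open>After the change of variables both payoffs are integrals over one space, with the same
  time \<open>\<sigma>\<close>, differing only in the measure argument of \<open>F\<close>. The
  absolute difference integrates to the mean gap.\<close>

lemma game_payoff_deviation:
  assumes i: "i \<in> {1..n}" and \<sigma> [measurable]: "\<sigma> \<in> P0 \<Otimes>\<^sub>M P1 \<rightarrow>\<^sub>M BT T"
  shows "\<bar>game_payoff T P0 P1 F n (profile(i := \<lambda>x. \<sigma> (fst x, snd x i))) i - payoff P0 P1 F \<mu> \<sigma>\<bar>
    \<le> mean_gap n i \<sigma>"
proof -
  have n: "n \<ge> 1" using i by simp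
  interpret Q: prob_space "others i" by (rule prob_space_others)
  interpret W: prob_space "P0 \<Otimes>\<^sub>M P1" by unfold_locales
  interpret WQ: pair_prob_space "P0 \<Otimes>\<^sub>M P1" "others i" ..
  let ?M = "(P0 \<Otimes>\<^sub>M P1) \<Otimes>\<^sub>M others i"
  let ?h = "\<lambda>x. (fst (fst x), (snd x)(i := snd (fst x)))"
  let ?G = "\<lambda>x. F (fst x) (snd x i)
    (empirical T n (\<lambda>k. (profile(i := \<lambda>x. \<sigma> (fst x, snd x i))) k x)) (\<sigma> (fst x, snd x i))"
  let ?A = "\<lambda>x. F (fst (fst x)) (snd (fst x)) (emp n i (fst (fst x)) (\<sigma> (fst x)) (snd x)) (\<sigma> (fst x))"
  let ?B = "\<lambda>w. F (fst w) (snd w) (\<mu> (fst w)) (\<sigma> w)"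
  have h: "?h \<in> ?M \<rightarrow>\<^sub>M Obar P0 P1"
    unfolding Obar_def
    by (intro measurable_Pair measurable_fun_upd[where J = "{1..} - {i}"])
      (use i in \<open>auto simp: others_def\<close>)
  have comp [measurable]: "(\<lambda>x. \<tau> (fst x, snd x k)) \<in> Obar P0 P1 \<rightarrow>\<^sub>M BT T" if "k \<ge> 1" for k
    using measurable_compose[OF measurable_agent[OF that] \<tau>] .
  have comp\<sigma>: "(\<lambda>x. \<sigma> (fst x, snd x i)) \<in> Obar P0 P1 \<rightarrow>\<^sub>M BT T"
    using i by (intro measurable_compose[OF measurable_agent \<sigma>]) simp
  have G: "?G \<in> borel_measurable (Obar P0 P1)"
  proof (intro measurable_F comp\<sigma> measurable_empirical[OF n])
    fix k assume "k \<in> {1..n}"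
    then show "(profile(i := \<lambda>x. \<sigma> (fst x, snd x i))) k \<in> Obar P0 P1 \<rightarrow>\<^sub>M BT T"
      using comp comp\<sigma> by simp
  qed (use i in \<open>simp_all add: Obar_def\<close>)
  \<comment> \<open>Under \<open>?h\<close> the deviator's time depends on \<open>fst x\<close>
    alone, so the empirical measure of the game becomes \<open>emp\<close> with
    \<open>s = \<sigma> (fst x)\<close>.\<close>
  have dev: "(profile(i := \<lambda>x. \<sigma> (fst x, snd x i))) k (?h x) =
      (if k = i then \<sigma> (fst x) else \<tau> (fst (fst x), snd x k))" for k x
    by simp
  have "game_payoff T P0 P1 F n (profile(i := \<lambda>x. \<sigma> (fst x, snd x i))) i = (\<integral>x. ?G x \<partial>Obar P0 P1)"
    unfolding game_payoff_def using i by simp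
  also have "\<dots> = (\<integral>x. ?G x \<partial>distr ?M (Obar P0 P1) ?h)"
    using i by (intro arg_cong[where f = "\<lambda>M. \<integral>x. ?G x \<partial>M"] Obar_eq_distr) simp
  also have "\<dots> = (\<integral>x. ?G (?h x) \<partial>?M)"
    by (rule integral_distr[OF h G])
  also have "\<dots> = (\<integral>x. ?A x \<partial>?M)"
    unfolding emp_def dev by simp
  finally have game: "game_payoff T P0 P1 F n (profile(i := \<lambda>x. \<sigma> (fst x, snd x i))) i = (\<integral>x. ?A x \<partial>?M)" .
  have fst_M: "distr ?M (P0 \<Otimes>\<^sub>M P1) fst = P0 \<Otimes>\<^sub>M P1" by (rule Q.distr_pair_fst)
  have B: "?B \<in> borel_measurable (P0 \<Otimes>\<^sub>M P1)" by (intro measurable_F) measurable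
  have "payoff P0 P1 F \<mu> \<sigma> = (\<integral>w. ?B w \<partial>distr ?M (P0 \<Otimes>\<^sub>M P1) fst)"
    unfolding fst_M by (simp add: payoff_def)
  also have "\<dots> = (\<integral>x. ?B (fst x) \<partial>?M)"
    using B by (intro integral_distr) auto
  finally have mf: "payoff P0 P1 F \<mu> \<sigma> = (\<integral>x. ?B (fst x) \<partial>?M)" .
  have "integrable (distr ?M (P0 \<Otimes>\<^sub>M P1) fst) dominator"
    unfolding fst_M by (rule integrable_dominator)
  then have dom: "integrable ?M (\<lambda>x. dominator (fst x))"
    by (rule integrable_distr[rotated]) simp
  have "AE w in distr ?M (P0 \<Otimes>\<^sub>M P1) fst. \<forall>m\<in>space (PT T). \<forall>t\<in>T. \<bar>F (fst w) (snd w) m t\<bar> \<le> dominator w"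
    unfolding fst_M by (rule AE_abs_F_le_dominator)
  then have AE_dom: "AE x in ?M. \<forall>m\<in>space (PT T). \<forall>t\<in>T. \<bar>F (fst (fst x)) (snd (fst x)) m t\<bar> \<le> dominator (fst x)"
    by (rule AE_distrD[rotated]) simp
  have spaces: "fst (fst x) \<in> space P0" "snd x \<in> space (others i)" "\<sigma> (fst x) \<in> T" if "x \<in> space ?M" for x
    using that measurable_space[OF \<sigma>, of "fst x"] by (auto simp: space_pair_measure)
  have A_meas: "?A \<in> borel_measurable ?M"
    by (intro measurable_F measurable_emp n) measurable
  have "AE x in ?M. norm (?A x) \<le> norm (dominator (fst x))"
    using AE_dom AE_space
  proof eventually_elim
    case (elim x)
    have "emp n i (fst (fst x)) (\<sigma> (fst x)) (snd x) \<in> space (PT T)"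
      using spaces[OF elim(2)] n by (intro emp_in_space_PT)
    then show ?case using elim(1) spaces[OF elim(2)] dominator_nonneg by simp
  qed
  with dom A_meas have intA: "integrable ?M ?A" by (rule Bochner_Integration.integrable_bound)
  have "AE x in ?M. norm (?B (fst x)) \<le> norm (dominator (fst x))"
    using AE_dom AE_space
  proof eventually_elim
    case (elim x)
    have "\<mu> (fst (fst x)) \<in> space (PT T)"
      using spaces[OF elim(2)] by (intro \<mu>_in_space_PT)
    then show ?case using elim(1) spaces[OF elim(2)] dominator_nonneg by simp
  qed
  with dom measurable_compose[OF measurable_fst B] have intB: "integrable ?M (\<lambda>x. ?B (fst x))"
    by (rule Bochner_Integration.integrable_bound)
  have "\<bar>game_payoff T P0 P1 F n (profile(i := \<lambda>x. \<sigma> (fst x, snd x i))) i - payoff P0 P1 F \<mu> \<sigma>\<bar>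
      = \<bar>\<integral>x. ?A x - ?B (fst x) \<partial>?M\<bar>"
    unfolding game mf using intA intB by simp
  also have "\<dots> \<le> (\<integral>x. \<bar>?A x - ?B (fst x)\<bar> \<partial>?M)"
    by (rule integral_abs_bound)
  \<comment> \<open>Fubini, justified by integrability of both rewards, puts the opponents in the
    inner integral.\<close>
  also have "\<dots> = (\<integral>w. \<integral>v. \<bar>?A (w, v) - ?B w\<bar> \<partial>others i \<partial>(P0 \<Otimes>\<^sub>M P1))"
    using WQ.integral_fst'[OF integrable_abs[OF Bochner_Integration.integrable_diff[OF intA intB]]] by simp
  also have "\<dots> = mean_gap n i \<sigma>"
    by (simp add: mean_gap_def gap_def)
  finally show ?thesis .
qed

text \<open>Deviating to \<open>\<tau>\<close> changes nothing, so the estimate for deviations also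
  covers the payoff of the profile itself.\<close>

lemma profile_upd_self: "profile(i := \<lambda>x. \<tau> (fst x, snd x i)) = profile"
  by (simp add: fun_eq_iff)

lemma game_payoff_tendsto:
  assumes "k \<ge> 1"
  shows "(\<lambda>n. game_payoff T P0 P1 F n profile k) \<longlonglongrightarrow> payoff P0 P1 F \<mu> \<tau>"
proof (rule LIM_zero_cancel)
  \<comment> \<open>For \<open>n < k\<close> agent \<open>k\<close> is not in the game; agent 1
    fills these finitely many terms to keep the index in range.\<close>
  have gap: "(\<lambda>n. mean_gap n (if n \<ge> k then k else 1) \<tau>) \<longlonglongrightarrow> 0"
    using assms by (intro mean_gap_tendsto_0 \<tau>) auto
  show "(\<lambda>n. game_payoff T P0 P1 F n profile k - payoff P0 P1 F \<mu> \<tau>) \<longlonglongrightarrow> 0"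
  proof (rule Lim_null_comparison[OF _ gap])
    show "\<forall>\<^sub>F n in sequentially. norm (game_payoff T P0 P1 F n profile k - payoff P0 P1 F \<mu> \<tau>)
        \<le> mean_gap n (if n \<ge> k then k else 1) \<tau>"
      using eventually_ge_at_top[of k]
    proof eventually_elim
      case (elim n)
      then show ?case
        using game_payoff_deviation[of k n \<tau>] assms \<tau> unfolding profile_upd_self by simp
    qed
  qed
qed

lemma ex_uniform_mean_gap_bound:
  "\<exists>\<Delta> :: nat \<Rightarrow> real. (\<forall>n. 0 \<le> \<Delta> n) \<and> \<Delta> \<longlonglongrightarrow> 0 \<and>
    (\<forall>n. \<forall>i\<in>{1..n}. \<forall>\<sigma>\<in>P0 \<Otimes>\<^sub>M P1 \<rightarrow>\<^sub>M BT T. mean_gap n i \<sigma> \<le> \<Delta> n)"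
proof -
  define S where "S n = (\<lambda>(i, \<sigma>). mean_gap n i \<sigma>) ` ({1..n} \<times> (P0 \<Otimes>\<^sub>M P1 \<rightarrow>\<^sub>M BT T))" for n
  \<comment> \<open>Inserting 0 gives nonnegativity and keeps the set nonempty at
    \<open>n = 0\<close>, where there are no agents.\<close>
  define \<Delta> where "\<Delta> n = Sup (insert 0 (S n))" for n
  have "bdd_above (S n)" for n
  proof (rule bdd_aboveI)
    fix x assume "x \<in> S n"
    then obtain i \<sigma> where "i \<in> {1..n}" "\<sigma> \<in> P0 \<Otimes>\<^sub>M P1 \<rightarrow>\<^sub>M BT T" "x = mean_gap n i \<sigma>"
      by (auto simp: S_def)
    then show "x \<le> (\<integral>w. 2 * dominator w \<partial>(P0 \<Otimes>\<^sub>M P1))"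
      using mean_gap_le[of n \<sigma> i] by simp
  qed
  then have bdd: "bdd_above (insert 0 (S n))" for n by simp
  have nonneg: "0 \<le> \<Delta> n" for n
    unfolding \<Delta>_def using bdd by (intro cSup_upper) auto
  have "\<Delta> \<longlonglongrightarrow> 0"
  proof (rule tendstoI)
    fix e :: real assume "e > 0"
    then have "\<forall>\<^sub>F n in sequentially. \<forall>i\<in>{1..n}. \<forall>\<sigma>\<in>P0 \<Otimes>\<^sub>M P1 \<rightarrow>\<^sub>M BT T. mean_gap n i \<sigma> \<le> e / 2"
      by (intro eventually_mean_gap_le) simp
    then show "\<forall>\<^sub>F n in sequentially. dist (\<Delta> n) 0 < e"
    proof eventually_elim
      case (elim n)
      have "\<Delta> n \<le> e / 2"
        unfolding \<Delta>_def using elim \<open>e > 0\<close> by (intro cSup_least) (auto simp: S_def)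
      then show ?case using nonneg[of n] \<open>e > 0\<close> by (simp add: dist_real_def)
    qed
  qed
  moreover have "mean_gap n i \<sigma> \<le> \<Delta> n" if "i \<in> {1..n}" "\<sigma> \<in> P0 \<Otimes>\<^sub>M P1 \<rightarrow>\<^sub>M BT T" for n i \<sigma>
    unfolding \<Delta>_def using that by (intro cSup_upper bdd) (force simp: S_def)
  ultimately show ?thesis using nonneg by blast
qed

end

section \<open>Transfer of stopping times between one agent and the product space\<close>

lemma measurable_stopping_time_on:
  "stopping_time_on T M Fi \<sigma> \<Longrightarrow> \<sigma> \<in> M \<rightarrow>\<^sub>M BT T"
  unfolding stopping_time_on_def BT_def by (intro measurable_restrict_space2) auto

lemma sets_agent_filtration:
  assumes "filtration_on T (P0 \<Otimes>\<^sub>M P1) Fsig" "i \<ge> 1" "t \<in> T"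
  shows "sets (agent_filtration P0 P1 Fsig i t) =
    {(\<lambda>x. (fst x, snd x i)) -` A \<inter> space (Obar P0 P1) | A. A \<in> sets (Fsig t)}"
  unfolding agent_filtration_def
proof (rule sets_vimage_algebra2)
  have "space (Fsig t) = space (P0 \<Otimes>\<^sub>M P1)"
    using assms by (simp add: filtration_on_def subalgebra_def)
  then show "(\<lambda>x. (fst x, snd x i)) \<in> space (Obar P0 P1) \<rightarrow> space (Fsig t)"
    using assms(2) by (auto simp: Obar_def space_pair_measure space_PiM)
qed

lemma stopping_time_on_agent:
  assumes filt: "filtration_on T (P0 \<Otimes>\<^sub>M P1) Fsig" and i: "i \<ge> 1"
    and \<sigma>: "stopping_time_on T (P0 \<Otimes>\<^sub>M P1) Fsig \<sigma>"
  shows "stopping_time_on T (Obar P0 P1) (agent_filtration P0 P1 Fsig i) (\<lambda>x. \<sigma> (fst x, snd x i))"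
proof -
  have \<pi>: "(\<lambda>x. (fst x, snd x i)) \<in> Obar P0 P1 \<rightarrow>\<^sub>M P0 \<Otimes>\<^sub>M P1"
    by (rule measurable_agent[OF i])
  show ?thesis
    unfolding stopping_time_on_def
  proof (intro conjI ballI)
    show "\<sigma> (fst x, snd x i) \<in> T" if "x \<in> space (Obar P0 P1)" for x
      using measurable_space[OF \<pi> that] \<sigma> by (simp add: stopping_time_on_def)
    show "(\<lambda>x. \<sigma> (fst x, snd x i)) \<in> borel_measurable (Obar P0 P1)"
      using \<sigma> by (intro measurable_compose[OF \<pi>]) (simp add: stopping_time_on_def)
    fix t assume t: "t \<in> T"
    have "{w \<in> space (P0 \<Otimes>\<^sub>M P1). \<sigma> w \<le> t} \<in> sets (Fsig t)"
      using \<sigma> t by (simp add: stopping_time_on_def)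
    moreover have "{x \<in> space (Obar P0 P1). \<sigma> (fst x, snd x i) \<le> t} =
        (\<lambda>x. (fst x, snd x i)) -` {w \<in> space (P0 \<Otimes>\<^sub>M P1). \<sigma> w \<le> t} \<inter> space (Obar P0 P1)"
      using measurable_space[OF \<pi>] by auto
    ultimately show "{x \<in> space (Obar P0 P1). \<sigma> (fst x, snd x i) \<le> t} \<in> sets (agent_filtration P0 P1 Fsig i t)"
      unfolding sets_agent_filtration[OF filt i t] by blast
  qed
qed

text \<open>An \<open>agent_filtration\<close>-stopping time is constant on the fibres of the projection to agent \<open>i\<close>'s own
  noise, so it factors through it; precomposing with a measurable section yields the factor.\<close>

lemma agent_stopping_time_factors:
  fixes P0 :: "'a measure" and P1 :: "'b measure"
  assumes filt: "filtration_on T (P0 \<Otimes>\<^sub>M P1) Fsig" and i: "i \<ge> 1"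
    and \<sigma>: "stopping_time_on T (Obar P0 P1) (agent_filtration P0 P1 Fsig i) \<sigma>"
  obtains \<sigma>' where "stopping_time_on T (P0 \<Otimes>\<^sub>M P1) Fsig \<sigma>'"
    and "\<And>x. x \<in> space (Obar P0 P1) \<Longrightarrow> \<sigma> x = \<sigma>' (fst x, snd x i)"
proof -
  let ?\<pi> = "\<lambda>x :: 'a \<times> (nat \<Rightarrow> 'b). (fst x, snd x i)"
  \<comment> \<open>The section gives every agent the same noise \<open>snd w\<close>, so projecting
    to agent \<open>i\<close> recovers \<open>w\<close>.\<close>
  define sec where "sec w = (fst w, \<lambda>k\<in>{1::nat..}. snd w)" for w :: "'a \<times> 'b"
  define \<sigma>' where "\<sigma>' w = \<sigma> (sec w)" for w
  have sec: "sec \<in> P0 \<Otimes>\<^sub>M P1 \<rightarrow>\<^sub>M Obar P0 P1"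
    unfolding sec_def Obar_def by measurable
  have \<pi>_sec: "?\<pi> (sec w) = w" for w
    using i by (simp add: sec_def)
  have \<pi>: "?\<pi> \<in> Obar P0 P1 \<rightarrow>\<^sub>M P0 \<Otimes>\<^sub>M P1"
    by (rule measurable_agent[OF i])
  have \<sigma>T: "\<sigma> x \<in> T" if "x \<in> space (Obar P0 P1)" for x
    using \<sigma> that by (simp add: stopping_time_on_def)
  have ex: "\<exists>A\<in>sets (Fsig t). \<forall>x\<in>space (Obar P0 P1). \<sigma> x \<le> t \<longleftrightarrow> ?\<pi> x \<in> A" if t: "t \<in> T" for t
  proof -
    have "{x \<in> space (Obar P0 P1). \<sigma> x \<le> t} \<in> sets (agent_filtration P0 P1 Fsig i t)"
      using \<sigma> t by (simp add: stopping_time_on_def)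
    then obtain A where "A \<in> sets (Fsig t)" "{x \<in> space (Obar P0 P1). \<sigma> x \<le> t} = ?\<pi> -` A \<inter> space (Obar P0 P1)"
      unfolding sets_agent_filtration[OF filt i t] by blast
    then show ?thesis by blast
  qed
  \<comment> \<open>At the level \<open>t = \<sigma> y\<close>, the event that
    \<open>\<sigma>\<close> is at most \<open>t\<close> is a preimage under the projection; it
    contains \<open>y\<close>, hence also \<open>x\<close>. Exchanging \<open>x\<close> and
    \<open>y\<close> gives equality.\<close>
  have le: "\<sigma> x \<le> \<sigma> y" if "x \<in> space (Obar P0 P1)" "y \<in> space (Obar P0 P1)" "?\<pi> x = ?\<pi> y" for x y
    using ex[OF \<sigma>T[OF that(2)]] that by (metis order_refl)
  show thesis
  proof
    show "\<sigma> x = \<sigma>' (?\<pi> x)" if x: "x \<in> space (Obar P0 P1)" for x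
    proof -
      have "sec (?\<pi> x) \<in> space (Obar P0 P1)"
        using measurable_space[OF sec measurable_space[OF \<pi> x]] .
      then show ?thesis
        unfolding \<sigma>'_def using x \<pi>_sec[of "?\<pi> x"] by (intro antisym le) simp_all
    qed
    show "stopping_time_on T (P0 \<Otimes>\<^sub>M P1) Fsig \<sigma>'"
      unfolding stopping_time_on_def
    proof (intro conjI ballI)
      show "\<sigma>' w \<in> T" if "w \<in> space (P0 \<Otimes>\<^sub>M P1)" for w
        using \<sigma>T measurable_space[OF sec that] by (simp add: \<sigma>'_def)
      show "\<sigma>' \<in> borel_measurable (P0 \<Otimes>\<^sub>M P1)"
        unfolding \<sigma>'_def using \<sigma> by (intro measurable_compose[OF sec]) (simp add: stopping_time_on_def)
      fix t assume t: "t \<in> T"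
      obtain A where A: "A \<in> sets (Fsig t)" "\<And>x. x \<in> space (Obar P0 P1) \<Longrightarrow> \<sigma> x \<le> t \<longleftrightarrow> ?\<pi> x \<in> A"
        using ex[OF t] by blast
      have "A \<subseteq> space (P0 \<Otimes>\<^sub>M P1)"
        using sets.sets_into_space[OF A(1)] filt t by (simp add: filtration_on_def subalgebra_def)
      then have "{w \<in> space (P0 \<Otimes>\<^sub>M P1). \<sigma>' w \<le> t} = A"
        using A(2)[OF measurable_space[OF sec]] \<pi>_sec unfolding \<sigma>'_def by auto
      then show "{w \<in> space (P0 \<Otimes>\<^sub>M P1). \<sigma>' w \<le> t} \<in> sets (Fsig t)" using A(1) by simp
    qed
  qed
qed

section \<open>The approximate equilibrium property\<close>

text \<open>One \<open>\<Delta>\<close> pays for replacing the payoff of the deviation by its mean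
  field value, the other for returning from the mean field value of \<open>\<tau>\<close> to the
  game; in between, \<open>opt\<close> compares the two.\<close>

lemma (in mean_field_limit) eps_Nash_profile:
  assumes filt: "filtration_on T (P0 \<Otimes>\<^sub>M P1) Fsig"
    and \<tau>_stop: "stopping_time_on T (P0 \<Otimes>\<^sub>M P1) Fsig \<tau>"
    and opt: "\<And>\<sigma>. stopping_time_on T (P0 \<Otimes>\<^sub>M P1) Fsig \<sigma> \<Longrightarrow> payoff P0 P1 F \<mu> \<sigma> \<le> payoff P0 P1 F \<mu> \<tau>"
    and \<Delta>: "\<And>i \<sigma>. i \<in> {1..n} \<Longrightarrow> \<sigma> \<in> P0 \<Otimes>\<^sub>M P1 \<rightarrow>\<^sub>M BT T \<Longrightarrow> mean_gap n i \<sigma> \<le> \<Delta>"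
  shows "eps_Nash T P0 P1 Fsig F n (2 * \<Delta>) profile"
  unfolding eps_Nash_def
proof (intro ballI conjI allI impI)
  fix i assume i: "i \<in> {1..n}"
  then have i1: "i \<ge> 1" by simp
  show "stopping_time_on T (Obar P0 P1) (agent_filtration P0 P1 Fsig i) (profile i)"
    by (rule stopping_time_on_agent[OF filt i1 \<tau>_stop])
  fix \<sigma> assume "stopping_time_on T (Obar P0 P1) (agent_filtration P0 P1 Fsig i) \<sigma>"
  then obtain \<sigma>' where \<sigma>': "stopping_time_on T (P0 \<Otimes>\<^sub>M P1) Fsig \<sigma>'"
    and eq: "\<And>x. x \<in> space (Obar P0 P1) \<Longrightarrow> \<sigma> x = \<sigma>' (fst x, snd x i)"
    using agent_stopping_time_factors[OF filt i1] by blast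
  have meas: "\<sigma>' \<in> P0 \<Otimes>\<^sub>M P1 \<rightarrow>\<^sub>M BT T" using \<sigma>' by (rule measurable_stopping_time_on)
  have "game_payoff T P0 P1 F n (profile(i := \<sigma>)) i =
      game_payoff T P0 P1 F n (profile(i := \<lambda>x. \<sigma>' (fst x, snd x i))) i"
    unfolding game_payoff_def
    by (intro Bochner_Integration.integral_cong refl arg_cong2[where f = "F _ _"]
        arg_cong[where f = "empirical T n"]) (auto simp: eq)
  then have "game_payoff T P0 P1 F n (profile(i := \<sigma>)) i \<le> payoff P0 P1 F \<mu> \<sigma>' + \<Delta>"
    using game_payoff_deviation[OF i meas] \<Delta>[OF i meas] by linarith
  also have "\<dots> \<le> payoff P0 P1 F \<mu> \<tau> + \<Delta>" using opt[OF \<sigma>'] by simp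
  also have "\<dots> \<le> game_payoff T P0 P1 F n profile i + 2 * \<Delta>"
    using game_payoff_deviation[OF i \<tau>] \<Delta>[OF i \<tau>] unfolding profile_upd_self by linarith
  finally show "game_payoff T P0 P1 F n (profile(i := \<sigma>)) i - 2 * \<Delta> \<le> game_payoff T P0 P1 F n profile i"
    by simp
qed

theorem mainTheorem2:
  fixes T :: "ennreal set"
    and P0 :: "'a measure" and F0 :: "ennreal \<Rightarrow> 'a measure"
    and P1 :: "'b measure" and F1 :: "ennreal \<Rightarrow> 'b measure"
    and Fsig :: "ennreal \<Rightarrow> ('a \<times> 'b) measure"
    and F :: "'a \<Rightarrow> 'b \<Rightarrow> ennreal measure \<Rightarrow> ennreal \<Rightarrow> real"
    and \<tau>star :: "'a \<times> 'b \<Rightarrow> ennreal"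
    and \<mu> :: "'a \<Rightarrow> ennreal measure"
  assumes "setting T P0 F0 P1 F1 Fsig"
    and "assumptionA T P0 P1 F"
    and "strong_MFE T P0 P1 Fsig F \<tau>star"
    and "cond_law T P0 P1 \<tau>star \<mu>"
  shows "\<exists>\<epsilon> :: nat \<Rightarrow> real. (\<forall>n. 0 \<le> \<epsilon> n) \<and> \<epsilon> \<longlonglongrightarrow> 0 \<and>
     (\<forall>n\<ge>1. eps_Nash T P0 P1 Fsig F n (\<epsilon> n) (\<lambda>k w. \<tau>star (fst w, snd w k))) \<and>
     (\<forall>k\<ge>1. (\<lambda>n. game_payoff T P0 P1 F n (\<lambda>j w. \<tau>star (fst w, snd w j)) k)
               \<longlonglongrightarrow> payoff P0 P1 F \<mu> \<tau>star)"
proof -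
  have P: "prob_space P0" "prob_space P1" and filt: "filtration_on T (P0 \<Otimes>\<^sub>M P1) Fsig"
    using assms(1) by (auto simp: setting_def)
  obtain \<mu>' where stop: "stopping_time_on T (P0 \<Otimes>\<^sub>M P1) Fsig \<tau>star"
    and \<mu>': "cond_law T P0 P1 \<tau>star \<mu>'"
    and opt: "\<And>\<sigma>. stopping_time_on T (P0 \<Otimes>\<^sub>M P1) Fsig \<sigma> \<Longrightarrow> payoff P0 P1 F \<mu>' \<sigma> \<le> payoff P0 P1 F \<mu>' \<tau>star"
    using assms(3) unfolding strong_MFE_def by blast
  have meas: "\<tau>star \<in> P0 \<Otimes>\<^sub>M P1 \<rightarrow>\<^sub>M BT T" using stop by (rule measurable_stopping_time_on)
  \<comment> \<open>Optimality is known for the version \<open>\<mu>'\<close> supplied by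
    \<open>strong_MFE\<close>, whereas the limit is claimed for the given version
    \<open>\<mu>\<close>. Each conclusion is derived with its own version, so the two are never
    compared.\<close>
  interpret eq: mean_field_limit P0 P1 T F \<tau>star \<mu>'
    using P assms(2) meas \<mu>' by (simp add: mean_field_limit_def mean_field_limit_axioms_def)
  interpret version: mean_field_limit P0 P1 T F \<tau>star \<mu>
    using P assms(2) meas assms(4) by (simp add: mean_field_limit_def mean_field_limit_axioms_def)
  obtain \<Delta> :: "nat \<Rightarrow> real" where \<Delta>: "\<And>n. 0 \<le> \<Delta> n" "\<Delta> \<longlonglongrightarrow> 0"
    and gap: "\<And>n i \<sigma>. i \<in> {1..n} \<Longrightarrow> \<sigma> \<in> P0 \<Otimes>\<^sub>M P1 \<rightarrow>\<^sub>M BT T \<Longrightarrow> eq.mean_gap n i \<sigma> \<le> \<Delta> n"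
    using eq.ex_uniform_mean_gap_bound by blast
  have "eps_Nash T P0 P1 Fsig F n (2 * \<Delta> n) (\<lambda>k w. \<tau>star (fst w, snd w k))" for n
    using filt stop opt gap by (rule eq.eps_Nash_profile)
  moreover have "(\<lambda>n. 2 * \<Delta> n) \<longlonglongrightarrow> 0"
    using tendsto_mult_right_zero[OF \<Delta>(2)] .
  moreover have "(\<lambda>n. game_payoff T P0 P1 F n (\<lambda>j w. \<tau>star (fst w, snd w j)) k)
      \<longlonglongrightarrow> payoff P0 P1 F \<mu> \<tau>star" if "k \<ge> 1" for k
    using that by (rule version.game_payoff_tendsto)
  ultimately show ?thesis
    using \<Delta>(1) by (intro exI[of _ "\<lambda>n. 2 * \<Delta> n"]) auto
qed

end
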